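(* Let $1<p<N$, let $\phi=\phi(\mathfrak A)$ be the basic determinantal process on $\mathcal N=\{1,\dots,N\}$ associated with orthonormal vectors $\mathfrak A=\{a^1,\dots,a^p\}\subset\mathbb R^N$ spanning $E$, and let $\{i\}$, $\{j\}$, $A=\{i_1,\dots,i_m\}$ be pairwise disjoint subsets of $\mathcal N$ with $|A|=m\le p$ and $0<\kappa<1$, where $\kappa=P\{A\subset\phi\}$. 1. If $m=p$, then $$P\{i\in\phi\mid A\not\subset\phi\}\,P\{j\in\phi\mid A\not\subset\phi\}-P\{i\in\phi,j\in\phi\mid A\not\subset\phi\}=(1-\kappa)^{-2}\big(\langle a_i,a_j\rangle^2+\kappa\|a_i\wedge a_j\|^2\big).$$ 2. If $m<p$ and the orthonormal basis $\mathfrak A$ of $E$ is in CS form relative to $(A,i,j)$ (see context), then $\kappa=\prod_{k=1}^{m}\cos^2\theta_k$, $$P\{i\in\phi\mid A\not\subset\phi\}\,P\{j\in\phi\mid A\not\subset\phi\}-P\{i\in\phi,j\in\phi\mid A\not\subset\phi\}$$ $$=(1-\kappa)^{-2}\Big[\big(\langle\tilde v_1,\tilde v_2\rangle+(1-\kappa)\langle W_1,W_2\rangle\big)^2+\kappa\|\tilde v_1\wedge\tilde v_2\|^2\Big],$$ and moreover $$\langle\tilde v_1,\tilde v_2\rangle+(1-\kappa)\langle W_1,W_2\rangle=\langle a_i,a_j\rangle-\Big\langle a_i\wedge\bigwedge_{k=1}^{m}a_{i_k},\ a_j\wedge\bigwedge_{k=1}^{m}a_{i_k}\Big\rangle .$$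 The right-hand sides of the formula in 1 and of the last formula in 2 do not depend on the choice of the orthonormal basis of $E$. As a consequence, the inequality $$P\{A\not\subset\phi\mid A_1\not\subset\phi,\ A_2\not\subset\phi\}\le P\{A\not\subset\phi\mid A_1\not\subset\phi\}$$ holds for all pairwise disjoint subsets $A,A_1,A_2$ of $\mathcal N$ such that $P\{A_1\not\subset\phi,A_2\not\subset\phi\}>0$.
   Context: Exterior powers of Euclidean space carry the inner product $\langle x_1\wedge\dots\wedge x_r,\,y_1\wedge\dots\wedge y_r\rangle=\det(\langle x_s,y_t\rangle)$ and the associated norm. Basic determinantal process: for $1<p<N$ and orthonormal vectors $a^k=(a^k_1,\dots,a^k_N)^t\in\mathbb R^N$, $k=1,\dots,p$, put $a_i=(a^1_i,\dots,a^p_i)\in\mathbb R^p$ for $i\in\mathcal N=\{1,\dots,N\}$. The process $\phi=\phi(\mathfrak A)$ is the random subset of $\mathcal N$ of cardinality $p$ with $P\{\phi=\{i_1,\dots,i_p\}\}=[\det(a^k_{i_j})_{k,j=1,\dots,p}]^2$. It depends only on $E=\mathrm{span}(\mathfrak A)$, and $P\{B\subset\phi\}=\|\bigwedge_{i\in B}a_i\|^2$ for every $B\subset\mathcal N$. CS form relative to $(A,i,j)$, where $A=\{i_1,\dots,i_m\}$, $m<p$: order the coordinates of $\mathbb R^N$ as $(i_1,\dots,i_m,i,j,\text{remaining indices})$ and write $\mathbb R^N=\mathbb R^m\times\mathbb R^{N-m}$. The basis $\mathfrak A$ is in CS form if there are orthonormal vectors $u^1,\dots,u^m\in\mathbb R^m$,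 mutually orthonormal vectors $V^1,\dots,V^m,W^1,\dots,W^{p-m}\in\mathbb R^{N-m}$ and angles $\theta_1,\dots,\theta_m\in[0,\pi/2]$ (the principal angles between $E$ and the coordinate subspace of vectors supported on $A$) such that $a^k=(\cos\theta_k\,u^k,\ \sin\theta_k\,V^k)$ for $1\le k\le m$ and $a^{m+k}=(0,W^k)$ for $1\le k\le p-m$. In this case (the first two coordinates of $\mathbb R^{N-m}$ being those indexed by $i$ and $j$) put, for $l=1,2$, $\tilde v_l=(V^1_l\sin\theta_1,\dots,V^m_l\sin\theta_m)$ and $W_l=(W^1_l,\dots,W^{p-m}_l)$, so that $a_i=(\tilde v_1,W_1)$ and $a_j=(\tilde v_2,W_2)$. *)

theory Defs
  imports
    "HOL-Probability.Probability"
    "Jordan_Normal_Form.Determinant"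
    "Jordan_Normal_Form.VS_Connect"
    "Jordan_Normal_Form.DL_Submatrix"
begin

hide_const (open) Determinants.det Finite_Cartesian_Product.vec Finite_Cartesian_Product.mat
  Finite_Cartesian_Product.row Finite_Cartesian_Product.column
no_notation inner (infix "\<bullet>" 70)

text \<open>
  All indices start at 0: the ground set is \<open>{..<N}\<close>, and the vectors
  \<open>a\<^sup>1, \<dots>, a\<^sup>p\<close> are the rows of a real matrix \<open>M\<close> with \<open>p\<close> rows and \<open>N\<close> columns,
  so that \<open>a\<^sub>i\<close> is \<open>col M i\<close>.
\<close>

definition orthonormal :: "nat \<Rightarrow> real vec list \<Rightarrow> bool" where
  "orthonormal n xs \<longleftrightarrow> set xs \<subseteq> carrier_vec n \<and>
     (\<forall>s < length xs. \<forall>t < length xs. xs ! s \<bullet> xs ! t = (if s = t then 1 else 0))"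

text \<open>
  The inner product \<open>\<langle>x\<^sub>1 \<and> \<dots> \<and> x\<^sub>r, y\<^sub>1 \<and> \<dots> \<and> y\<^sub>r\<rangle>\<close> of two decomposable multivectors.  For lists of
  different lengths it is 0, because \<open>det\<close> is 0 on non-square matrices.
\<close>

definition wedge_inner :: "real vec list \<Rightarrow> real vec list \<Rightarrow> real" where
  "wedge_inner xs ys = det (mat (length xs) (length ys) (\<lambda>(s, t). xs ! s \<bullet> ys ! t))"

definition wedge_norm :: "real vec list \<Rightarrow> real" where
  "wedge_norm xs = sqrt (wedge_inner xs xs)"

text \<open>
  The law of the basic determinantal process.  The weights sum to 1, as \<open>embed_pmf\<close> needs, when the
  rows of \<open>M\<close> are orthonormal (Cauchy-Binet).
\<close>

definition det_process :: "real mat \<Rightarrow> nat set pmf" where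
  "det_process M = embed_pmf (\<lambda>S.
     if S \<subseteq> {..<dim_col M} \<and> card S = dim_row M then (det (submatrix M UNIV S))\<^sup>2 else 0)"

definition reorder :: "nat list \<Rightarrow> real vec \<Rightarrow> real vec" where
  "reorder ks x = vec (length ks) (\<lambda>s. x $ (ks ! s))"

text \<open>
  CS form relative to \<open>(A, i, j)\<close>, where \<open>is\<close> lists the elements of \<open>A\<close> and \<open>rs\<close> the indices other
  than those of \<open>A\<close>, \<open>i\<close> and \<open>j\<close>.  The angles need no separate description as principal angles:
  the orthonormality conditions force them to be those between the row space of \<open>M\<close> and the
  coordinate subspace of \<open>A\<close>.
\<close>

definition cs_form ::
  "real mat \<Rightarrow> nat list \<Rightarrow> nat \<Rightarrow> nat \<Rightarrow> nat list \<Rightarrow>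
   real list \<Rightarrow> real vec list \<Rightarrow> real vec list \<Rightarrow> real vec list \<Rightarrow> bool" where
  "cs_form M is i j rs \<theta>s us Vs Ws \<longleftrightarrow>
     (let p = dim_row M; N = dim_col M; m = length is; ks = is @ [i, j] @ rs in
       distinct ks \<and> set ks = {..<N} \<and>
       length \<theta>s = m \<and> length us = m \<and> length Vs = m \<and> length Ws = p - m \<and>
       (\<forall>k < m. \<theta>s ! k \<in> {0..pi / 2}) \<and>
       orthonormal m us \<and> orthonormal (N - m) (Vs @ Ws) \<and>
       (\<forall>k < m. reorder ks (row M k) =
          cos (\<theta>s ! k) \<cdot>\<^sub>v us ! k @\<^sub>v sin (\<theta>s ! k) \<cdot>\<^sub>v Vs ! k) \<and>
       (\<forall>k < p - m. reorder ks (row M (m + k)) = 0\<^sub>v m @\<^sub>v Ws ! k))"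

text \<open>The vectors \<open>v~\<^sub>l\<close> and \<open>W\<^sub>l\<close>, with \<open>l\<close> counted from 0.\<close>

definition v_tilde :: "real list \<Rightarrow> real vec list \<Rightarrow> nat \<Rightarrow> real vec" where
  "v_tilde \<theta>s Vs l = vec (length Vs) (\<lambda>k. Vs ! k $ l * sin (\<theta>s ! k))"

definition W_coord :: "real vec list \<Rightarrow> nat \<Rightarrow> real vec" where
  "W_coord Ws l = vec (length Ws) (\<lambda>k. Ws ! k $ l)"

end

theory Submission
  imports Defs
begin

text \<open>
  By Cauchy--Binet the process is well defined and \<open>P{B \<subseteq> \<phi>}\<close> is the Gram determinant of the columns
  in \<open>B\<close>.  Let \<open>Q\<close> be the orthogonal projection onto the span of the columns in \<open>A\<close>, and split
  \<open>\<langle>x, y\<rangle> = v + w\<close> into \<open>v = \<langle>Q x, Q y\<rangle>\<close> and \<open>w = \<langle>x - Q x, y - Q y\<rangle>\<close>.  Gram determinants of lists extending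
  \<open>A\<close> are \<open>\<kappa>\<close> times Gram determinants of residuals, so the correlation formula is a polynomial
  identity in \<open>\<kappa>\<close>, the \<open>v\<close> and the \<open>w\<close>, with right-hand side \<open>(v + (1 - \<kappa>) w)\<^sup>2 + \<kappa> \<parallel>Q x \<and> Q y\<parallel>\<^sup>2\<close>.
  For \<open>|A| = p\<close> the projection is the identity; in CS form
  it is the projection onto the first \<open>m\<close> coordinates.

  For the final inequality, the correlation formula applied to the residuals of the columns outside \<open>F\<close>
  shows that \<open>h F = P{F \<subseteq> \<phi>, \<not> A\<^sub>1 \<subseteq> \<phi>}\<close> satisfies
  \<open>h (F \<union> {i, j}) h F \<le> h (F \<union> {i}) h (F \<union> {j})\<close>.  Induction extends this to
  \<open>h (A \<union> B) h {} \<le> h A h B\<close>, which is the claim.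
\<close>

no_notation vec_nth (infixl "$" 90)

subsection \<open>The Cauchy--Binet formula\<close>

text \<open>Row \<open>i\<close> of \<open>A * B\<close> is the combination of the rows of
  \<open>B\<close> with coefficients \<open>A $$ (i, k)\<close>, so multilinearity gives a sum over
  all maps \<open>f\<close>; a non-injective \<open>f\<close> repeats a row of \<open>B\<close> and
  contributes 0. Fixing \<open>f i = i\<close> outside the range leaves one representative per
  map.\<close>

lemma det_mult_sum_injective:
  fixes A B :: "'a :: comm_ring_1 mat"
  assumes A: "A \<in> carrier_mat p n" and B: "B \<in> carrier_mat n p"
  shows "det (A * B) =
    (\<Sum>f | (\<forall>i\<in>{0..<p}. f i \<in> {0..<n}) \<and> (\<forall>i. i \<notin> {0..<p} \<longrightarrow> f i = i) \<and> inj_on f {0..<p}.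
      det (mat\<^sub>r p p (\<lambda>i. A $$ (i, f i) \<cdot>\<^sub>v row B (f i))))"
    (is "_ = sum ?T ?I")
proof -
  let ?F = "{f. (\<forall>i\<in>{0..<p}. f i \<in> {0..<n}) \<and> (\<forall>i. i \<notin> {0..<p} \<longrightarrow> f i = i)}"
  have "det (A * B) = sum ?T ?F"
    unfolding mat_mul_finsum_alt[OF A B]
    by (rule det_linear_rows_sum, insert A B, auto)
  also have "\<dots> = sum ?T ?I"
  proof (rule sum.mono_neutral_right)
    show "finite ?F" by (rule finite_bounded_functions) auto
    show "?I \<subseteq> ?F" by auto
    show "\<forall>f \<in> ?F - ?I. ?T f = 0"
    proof
      fix f assume f: "f \<in> ?F - ?I"
      then obtain i j where ij: "i \<noteq> j" "i < p" "j < p" "f i = f j"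
        unfolding inj_on_def by auto
      let ?B = "mat\<^sub>r p p (\<lambda>i. row B (f i))"
      have "?T f = prod (\<lambda>i. A $$ (i, f i)) {0..<p} * det ?B"
        by (rule det_rows_mul) (use f B in auto)
      moreover have "det ?B = 0"
        by (rule det_identical_rows[OF _ ij(1-3)]) (use ij in auto)
      ultimately show "?T f = 0" by simp
    qed
  qed
  finally show ?thesis .
qed

lemma bij_betw_pick:
  assumes "finite S"
  shows "bij_betw (pick S) {0..<card S} S"
proof -
  have inj: "inj_on (pick S) {0..<card S}"
    by (rule linorder_inj_onI) (use pick_mono_le in fastforce)+
  moreover have "pick S ` {0..<card S} \<subseteq> S" using pick_in_set_le by auto
  ultimately show ?thesis
    unfolding bij_betw_def using assms
    by (metis card_atLeastLessThan card_image card_subset_eq diff_zero)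
qed

lemma submatrix_cols_carrier:
  assumes "A \<in> carrier_mat p n" "S \<subseteq> {..<n}"
  shows "submatrix A UNIV S \<in> carrier_mat p (card S)"
proof -
  have "{j. j < n \<and> j \<in> S} = S" using assms by auto
  then show ?thesis using assms by (auto simp: dim_submatrix)
qed

lemma submatrix_rows_carrier:
  assumes "A \<in> carrier_mat n p" "S \<subseteq> {..<n}"
  shows "submatrix A S UNIV \<in> carrier_mat (card S) p"
proof -
  have "{j. j < n \<and> j \<in> S} = S" using assms by auto
  then show ?thesis using assms by (auto simp: dim_submatrix)
qed

lemma submatrix_cols_index:
  assumes "A \<in> carrier_mat p n" "S \<subseteq> {..<n}" "i < p" "j < card S"
  shows "submatrix A UNIV S $$ (i, j) = A $$ (i, pick S j)"
proof -
  have "{j. j < n \<and> j \<in> S} = S" using assms by auto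
  then show ?thesis using assms by (subst submatrix_index) (auto simp: pick_UNIV)
qed

lemma submatrix_rows_index:
  assumes "A \<in> carrier_mat n p" "S \<subseteq> {..<n}" "i < card S" "j < p"
  shows "submatrix A S UNIV $$ (i, j) = A $$ (pick S i, j)"
proof -
  have "{j. j < n \<and> j \<in> S} = S" using assms by auto
  then show ?thesis using assms by (subst submatrix_index) (auto simp: pick_UNIV)
qed

text \<open>Group the injections \<open>f\<close> by their image \<open>S\<close>. Each is
  \<open>pick S\<close> after a permutation \<open>g\<close> of \<open>{0..<p}\<close>, and the sum
  over \<open>g\<close> is the same expansion for the product of the two square submatrices, where
  \<open>det\<close> is multiplicative.\<close>

theorem cauchy_binet:
  fixes A B :: "'a :: comm_ring_1 mat"
  assumes A: "A \<in> carrier_mat p n" and B: "B \<in> carrier_mat n p"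
  shows "det (A * B) =
    (\<Sum>S | S \<subseteq> {..<n} \<and> card S = p. det (submatrix A UNIV S) * det (submatrix B S UNIV))"
proof -
  define T where "T = (\<lambda>f. det (mat\<^sub>r p p (\<lambda>i. A $$ (i, f i) \<cdot>\<^sub>v row B (f i))))"
  define I where "I = (\<lambda>n. {f. (\<forall>i\<in>{0..<p}. f i \<in> {0..<n::nat}) \<and> (\<forall>i. i \<notin> {0..<p} \<longrightarrow> f i = i) \<and> inj_on f {0..<p}})"
  let ?P = "{S. S \<subseteq> {..<n} \<and> card S = p}"
  have finI: "finite (I n)" unfolding I_def
    by (rule finite_subset[OF _ finite_bounded_functions[of "{0..<n}" "{0..<p}"]]) auto
  have finP: "finite ?P" by (rule finite_subset[of _ "Pow {..<n}"]) auto
  have "det (A * B) = sum T (I n)"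
    unfolding T_def I_def by (rule det_mult_sum_injective[OF A B])
  also have "\<dots> = (\<Sum>S\<in>?P. sum T {f \<in> I n. f ` {0..<p} = S})"
  proof (rule sum.group[symmetric, OF finI finP])
    show "(\<lambda>f. f ` {0..<p}) ` I n \<subseteq> ?P" by (auto simp: I_def card_image)
  qed
  also have "\<dots> = (\<Sum>S\<in>?P. det (submatrix A UNIV S) * det (submatrix B S UNIV))"
  proof (rule sum.cong[OF refl])
    fix S assume "S \<in> ?P"
    then have S: "S \<subseteq> {..<n}" "card S = p" and finS: "finite S" by (auto intro: finite_subset)
    let ?A = "submatrix A UNIV S" and ?B = "submatrix B S UNIV"
    have cA: "?A \<in> carrier_mat p p" using submatrix_cols_carrier[OF A S(1)] S by simp
    have cB: "?B \<in> carrier_mat p p" using submatrix_rows_carrier[OF B S(1)] S by simp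
    have pick: "bij_betw (pick S) {0..<p} S" using bij_betw_pick[OF finS] S by simp
    \<comment> \<open>\<open>ext\<close> turns an injection of \<open>{0..<p}\<close> into itself
      into one with image \<open>S\<close>, keeping the identity outside as \<open>I n\<close>
      demands.\<close>
    define ext where "ext = (\<lambda>g i. if i < p then pick S (g i) else (i :: nat))"
    have pickS: "pick S k \<in> S" if "k < p" for k using pick that by (auto simp: bij_betw_def)
    have bij: "bij_betw ext (I p) {f \<in> I n. f ` {0..<p} = S}"
    proof (rule bij_betw_byWitness)
      let ?back = "\<lambda>f i. if i < p then inv_into {0..<p} (pick S) (f i) else (i :: nat)"
      have pi: "pick S (inv_into {0..<p} (pick S) s) = s"
        "inv_into {0..<p} (pick S) s < p" if "s \<in> S" for s
        using pick that bij_betw_inv_into_right bij_betwE[OF bij_betw_inv_into[OF pick]] by fastforce+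
      have ip: "inv_into {0..<p} (pick S) (pick S k) = k" if "k < p" for k
        using pick that bij_betw_inv_into_left by fastforce
      show "\<forall>g\<in>I p. ?back (ext g) = g"
        by (auto simp: I_def ext_def ip fun_eq_iff)
      show "\<forall>f\<in>{f \<in> I n. f ` {0..<p} = S}. ext (?back f) = f"
      proof (intro ballI HOL.ext)
        fix f i assume f: "f \<in> {f \<in> I n. f ` {0..<p} = S}"
        then have "i < p \<Longrightarrow> f i \<in> S" by auto
        then show "ext (?back f) i = f i"
          using f pi by (cases "i < p") (auto simp: ext_def I_def)
      qed
      show "ext ` I p \<subseteq> {f \<in> I n. f ` {0..<p} = S}"
      proof
        fix f assume "f \<in> ext ` I p"
        then obtain g where g: "g \<in> I p" and f: "f = ext g" by auto
        have gi: "inj_on g {0..<p}" "g ` {0..<p} \<subseteq> {0..<p}" using g by (auto simp: I_def)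
        then have gs: "g ` {0..<p} = {0..<p}" by (simp add: endo_inj_surj)
        have "f ` {0..<p} = pick S ` g ` {0..<p}" unfolding f ext_def image_image by auto
        then have im: "f ` {0..<p} = S" using gs pick by (simp add: bij_betw_def)
        have "inj_on f {0..<p}" by (rule eq_card_imp_inj_on) (use im S in auto)
        then show "f \<in> {f \<in> I n. f ` {0..<p} = S}"
          using im S g by (auto simp: I_def f ext_def)
      qed
      show "?back ` {f \<in> I n. f ` {0..<p} = S} \<subseteq> I p"
      proof (rule image_subsetI)
        fix f assume f: "f \<in> {f \<in> I n. f ` {0..<p} = S}"
        then have fS: "f i \<in> S" if "i < p" for i using that by auto
        have "inj_on (?back f) {0..<p}"
        proof (rule inj_onI)
          fix i j assume ij: "i \<in> {0..<p}" "j \<in> {0..<p}" and eq: "?back f i = ?back f j"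
          then have "pick S (?back f i) = pick S (?back f j)" by simp
          then have "f i = f j" using ij pi(1) fS by simp
          then show "i = j" using f ij by (auto simp: I_def inj_on_def)
        qed
        then show "?back f \<in> I p"
          using pi(2)[OF fS] by (simp add: I_def)
      qed
    qed
    \<comment> \<open>The row expansion is reused with \<open>n = p\<close>; its index set
      \<open>I p\<close> then consists of the permutations.\<close>
    have "det ?A * det ?B = det (?A * ?B)" using det_mult[OF cA cB] by simp
    also have "\<dots> = (\<Sum>g\<in>I p. det (mat\<^sub>r p p (\<lambda>i. ?A $$ (i, g i) \<cdot>\<^sub>v row ?B (g i))))"
      unfolding I_def by (rule det_mult_sum_injective[OF cA cB])
    also have "\<dots> = (\<Sum>g\<in>I p. T (ext g))"
    proof (rule sum.cong[OF refl])
      fix g assume g: "g \<in> I p"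
      have "mat\<^sub>r p p (\<lambda>i. ?A $$ (i, g i) \<cdot>\<^sub>v row ?B (g i))
        = mat\<^sub>r p p (\<lambda>i. A $$ (i, ext g i) \<cdot>\<^sub>v row B (ext g i))"
      proof (rule eq_matI)
        fix i j assume "i < dim_row (mat\<^sub>r p p (\<lambda>i. A $$ (i, ext g i) \<cdot>\<^sub>v row B (ext g i)))"
          "j < dim_col (mat\<^sub>r p p (\<lambda>i. A $$ (i, ext g i) \<cdot>\<^sub>v row B (ext g i)))"
        then have ij: "i < p" "j < p" by auto
        have gi: "g i < p" using g ij by (auto simp: I_def)
        have "pick S (g i) < n" using pickS[OF gi] S by auto
        then show "mat\<^sub>r p p (\<lambda>i. ?A $$ (i, g i) \<cdot>\<^sub>v row ?B (g i)) $$ (i, j)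
          = mat\<^sub>r p p (\<lambda>i. A $$ (i, ext g i) \<cdot>\<^sub>v row B (ext g i)) $$ (i, j)"
          using ij gi A B cA cB S submatrix_cols_index[OF A S(1)] submatrix_rows_index[OF B S(1)]
          by (simp add: ext_def)
      qed auto
      then show "det (mat\<^sub>r p p (\<lambda>i. ?A $$ (i, g i) \<cdot>\<^sub>v row ?B (g i))) = T (ext g)"
        by (simp add: T_def)
    qed
    also have "\<dots> = sum T {f \<in> I n. f ` {0..<p} = S}"
      by (rule sum.reindex_bij_betw[OF bij])
    finally show "sum T {f \<in> I n. f ` {0..<p} = S} = det ?A * det ?B" by simp
  qed
  finally show ?thesis .
qed

text \<open>Cauchy-Binet for \<open>M\<close> and \<open>B\<close>, where \<open>B\<close> is the
  diagonal matrix of the \<open>d k\<close> times the transpose of \<open>M\<close>: the rows of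
  \<open>B\<close> in \<open>S\<close> form the transposed submatrix of \<open>M\<close> with rows
  scaled by \<open>d\<close>. The weights act as a generating variable for the size of
  \<open>S\<close> intersected with a given set; constant weight 1 gives the normalization.\<close>

lemma cauchy_binet_weighted:
  fixes M :: "'a :: comm_ring_1 mat" and d :: "nat \<Rightarrow> 'a"
  assumes M: "M \<in> carrier_mat p n"
  shows "det (mat p p (\<lambda>(i, j). \<Sum>k<n. d k * M $$ (i, k) * M $$ (j, k))) =
    (\<Sum>S | S \<subseteq> {..<n} \<and> card S = p. (det (submatrix M UNIV S))\<^sup>2 * (\<Prod>k\<in>S. d k))"
proof -
  define B where "B = mat n p (\<lambda>(k, j). d k * M $$ (j, k))"
  have B: "B \<in> carrier_mat n p" by (simp add: B_def)
  have "mat p p (\<lambda>(i, j). \<Sum>k<n. d k * M $$ (i, k) * M $$ (j, k)) = M * B"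
    by (rule eq_matI) (use M in \<open>auto simp: B_def scalar_prod_def lessThan_atLeast0 ac_simps intro!: sum.cong\<close>)
  also have "det (M * B) = (\<Sum>S | S \<subseteq> {..<n} \<and> card S = p. det (submatrix M UNIV S) * det (submatrix B S UNIV))"
    by (rule cauchy_binet[OF M B])
  also have "\<dots> = (\<Sum>S | S \<subseteq> {..<n} \<and> card S = p. (det (submatrix M UNIV S))\<^sup>2 * (\<Prod>k\<in>S. d k))"
  proof (rule sum.cong[OF refl], clarsimp)
    fix S assume S: "S \<subseteq> {..<n}" and p: "p = card S"
    have finS: "finite S" using S by (rule finite_subset) simp
    let ?M = "submatrix M UNIV S"
    have cM: "?M \<in> carrier_mat p p" using submatrix_cols_carrier[OF M S] p by simp
    have cB: "submatrix B S UNIV \<in> carrier_mat p p" using submatrix_rows_carrier[OF B S] p by simp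
    have pick: "bij_betw (pick S) {0..<p} S" using bij_betw_pick[OF finS] p by simp
    have pn: "pick S i < n" if "i < p" for i using pick that S by (auto simp: bij_betw_def)
    have "submatrix B S UNIV = mat\<^sub>r p p (\<lambda>i. d (pick S i) \<cdot>\<^sub>v row ?M\<^sup>T i)"
    proof (rule eq_matI)
      fix i j assume "i < dim_row (mat\<^sub>r p p (\<lambda>i. d (pick S i) \<cdot>\<^sub>v row ?M\<^sup>T i))"
        "j < dim_col (mat\<^sub>r p p (\<lambda>i. d (pick S i) \<cdot>\<^sub>v row ?M\<^sup>T i))"
      then have ij: "i < p" "j < p" by auto
      have "submatrix B S UNIV $$ (i, j) = d (pick S i) * M $$ (j, pick S i)"
        using ij p pn[OF ij(1)] by (subst submatrix_rows_index[OF B S]) (auto simp: B_def)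
      then show "submatrix B S UNIV $$ (i, j) = mat\<^sub>r p p (\<lambda>i. d (pick S i) \<cdot>\<^sub>v row ?M\<^sup>T i) $$ (i, j)"
        using ij p cM by (simp add: submatrix_cols_index[OF M S])
    qed (use cB in auto)
    then have "det (submatrix B S UNIV) = det (mat\<^sub>r p p (\<lambda>i. d (pick S i) \<cdot>\<^sub>v row ?M\<^sup>T i))"
      by simp
    also have "\<dots> = (\<Prod>i=0..<p. d (pick S i)) * det (mat\<^sub>r p p (\<lambda>i. row ?M\<^sup>T i))"
      by (rule det_rows_mul) (use cM in auto)
    also have "(\<Prod>i=0..<p. d (pick S i)) = (\<Prod>k\<in>S. d k)"
      by (rule prod.reindex_bij_betw[OF pick])
    also have "mat\<^sub>r p p (\<lambda>i. row ?M\<^sup>T i) = ?M\<^sup>T"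
      by (rule eq_matI) (use cM in auto)
    also have "det ?M\<^sup>T = det ?M" by (rule det_transpose[OF cM])
    finally show "det ?M * det (submatrix B S UNIV) = (det ?M)\<^sup>2 * prod d S"
      by (simp add: power2_eq_square ac_simps)
  qed
  finally show ?thesis .
qed

subsection \<open>Gram determinants and orthogonal projections\<close>

lemma wedge_inner_mat_of_cols:
  assumes "set xs \<subseteq> carrier_vec n" "set ys \<subseteq> carrier_vec n"
  shows "wedge_inner xs ys = det ((mat_of_cols n xs)\<^sup>T * mat_of_cols n ys)"
proof -
  have "mat (length xs) (length ys) (\<lambda>(s, t). xs ! s \<bullet> ys ! t) = (mat_of_cols n xs)\<^sup>T * mat_of_cols n ys"
    by (rule eq_matI) (use assms in \<open>auto simp: col_mat_of_cols[OF _ subsetD[OF _ nth_mem]]\<close>)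
  then show ?thesis by (simp add: wedge_inner_def)
qed

section \<open>Low-order Gram determinants\<close>

lemma wedge_inner_Nil [simp]: "wedge_inner [] [] = 1"
  by (simp add: wedge_inner_def)

lemma det_mat_1: "det (mat (Suc 0) (Suc 0) f) = f (0, 0)"
  by (subst det_single) auto

lemma det_mat_2:
  fixes f :: "nat \<times> nat \<Rightarrow> 'a :: idom"
  shows "det (mat (Suc (Suc 0)) (Suc (Suc 0)) f) = f (0, 0) * f (1, 1) - f (0, 1) * f (1, 0)"
proof -
  let ?A = "mat 1 1 (\<lambda>_. f (0, 0))" and ?B = "mat 1 1 (\<lambda>_. f (0, 1))"
    and ?C = "mat 1 1 (\<lambda>_. f (1, 0))" and ?D = "mat 1 1 (\<lambda>_. f (1, 1))"
  have eq: "mat (Suc (Suc 0)) (Suc (Suc 0)) f = four_block_mat ?A ?B ?C ?D"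
    by (rule eq_matI) (auto simp: less_Suc_eq)
  \<comment> \<open>The block formula requires the lower blocks to commute, which holds as they are
    1 by 1.\<close>
  have "det (four_block_mat ?A ?B ?C ?D) = det (?A * ?D - ?B * ?C)"
    by (rule det_four_block_mat[of _ 1]) (auto intro!: eq_matI simp: scalar_prod_def)
  also have "\<dots> = f (0, 0) * f (1, 1) - f (0, 1) * f (1, 0)"
    by (subst det_single) (auto simp: scalar_prod_def)
  finally show ?thesis unfolding eq .
qed

lemma wedge_inner_1: "wedge_inner [x] [y] = x \<bullet> y"
  by (simp add: wedge_inner_def det_mat_1)

lemma wedge_inner_2:
  "wedge_inner [x, y] [x', y'] = (x \<bullet> x') * (y \<bullet> y') - (x \<bullet> y') * (y \<bullet> x')"
  by (simp add: wedge_inner_def det_mat_2)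

lemma scalar_prod_Cauchy_Schwarz:
  fixes x y :: "real vec"
  assumes "x \<in> carrier_vec n" "y \<in> carrier_vec n"
  shows "(x \<bullet> y)\<^sup>2 \<le> (x \<bullet> x) * (y \<bullet> y)"
  using Cauchy_Schwarz_ineq_sum[of "\<lambda>i. x $ i" "\<lambda>i. y $ i" "{0..<n}"] assms
  by (simp add: scalar_prod_def power2_eq_square)

text \<open>Cauchy-Schwarz makes the Gram determinant nonnegative, so squaring undoes the
  \<open>sqrt\<close>.\<close>

lemma wedge_norm_2_squared:
  assumes "x \<in> carrier_vec n" "y \<in> carrier_vec n"
  shows "(wedge_norm [x, y])\<^sup>2 = (x \<bullet> x) * (y \<bullet> y) - (x \<bullet> y)\<^sup>2"
  using scalar_prod_Cauchy_Schwarz[OF assms] comm_scalar_prod[OF assms]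
  by (simp add: wedge_norm_def wedge_inner_2 power2_eq_square)

text \<open>The assumptions say that \<open>P\<close> is the orthogonal projection onto the span of \<open>fs\<close>; \<open>P = F Z\<close> encodes
  that its range lies in that span.\<close>

locale span_projection =
  fixes n :: nat and fs :: "real vec list" and P :: "real mat" and Z :: "real mat"
  assumes fs: "set fs \<subseteq> carrier_vec n"
    and P: "P \<in> carrier_mat n n" and PT: "P\<^sup>T = P"
    and PF: "P * mat_of_cols n fs = mat_of_cols n fs"
    and Z: "Z \<in> carrier_mat (length fs) n" and PZ: "P = mat_of_cols n fs * Z"
begin

lemma idem: "P * P = P"
  using assoc_mult_mat[OF P, of "mat_of_cols n fs" "length fs" Z n] Z PF PZ by simp

lemma in_carrier [simp]: "P *\<^sub>v x \<in> carrier_vec n"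
  using P by (simp add: carrier_dim_vec)

lemma symmetric:
  assumes "x \<in> carrier_vec n" "y \<in> carrier_vec n"
  shows "(P *\<^sub>v x) \<bullet> y = x \<bullet> (P *\<^sub>v y)"
  using transpose_vec_mult_scalar[OF P assms(2,1)] PT by simp

lemma idem_vec:
  assumes "x \<in> carrier_vec n"
  shows "P *\<^sub>v (P *\<^sub>v x) = P *\<^sub>v x"
  using assoc_mult_mat_vec[OF P P assms] idem by simp

lemma inner_projection:
  assumes "x \<in> carrier_vec n" "y \<in> carrier_vec n"
  shows "(P *\<^sub>v x) \<bullet> (P *\<^sub>v y) = x \<bullet> (P *\<^sub>v y)"
  using assms by (simp add: symmetric idem_vec)

lemma inner_residual:
  assumes "x \<in> carrier_vec n" "y \<in> carrier_vec n"
  shows "(x - P *\<^sub>v x) \<bullet> (y - P *\<^sub>v y) = x \<bullet> y - x \<bullet> (P *\<^sub>v y)"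
  using assms
  by (simp add: minus_scalar_prod_distrib[of _ n] scalar_prod_minus_distrib[of _ n] symmetric idem_vec)

lemma inner_commute:
  assumes "x \<in> carrier_vec n" "y \<in> carrier_vec n"
  shows "y \<bullet> (P *\<^sub>v x) = x \<bullet> (P *\<^sub>v y)"
  using assms symmetric[of y x] comm_scalar_prod[of "P *\<^sub>v y" n x] by simp

text \<open>A Schur complement: in the block Gram matrix, subtracting from the columns of
  \<open>ys\<close> their projections onto the span of \<open>fs\<close> clears the lower left
  block, and the matrix becomes block triangular.\<close>

lemma wedge_inner_append_det:
  assumes xs: "set xs \<subseteq> carrier_vec n" and ys: "set ys \<subseteq> carrier_vec n"
    and len: "length xs = length ys"
  shows "wedge_inner (xs @ fs) (ys @ fs) = wedge_inner fs fs *
    det (mat (length xs) (length ys) (\<lambda>(s, t). xs ! s \<bullet> ys ! t - xs ! s \<bullet> (P *\<^sub>v ys ! t)))"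
proof -
  define r m where "r = length ys" and "m = length fs"
  define X Y F where "X = mat_of_cols n xs" and "Y = mat_of_cols n ys" and "F = mat_of_cols n fs"
  have c: "X \<in> carrier_mat n r" "Y \<in> carrier_mat n r" "F \<in> carrier_mat n m"
    using len by (auto simp: X_def Y_def F_def r_def m_def)
  have Z: "Z \<in> carrier_mat m n" and PZ: "P = F * Z" and PF: "P * F = F"
    using Z PZ PF by (auto simp: F_def m_def)
  \<comment> \<open>The transposed form of \<open>P * F = F\<close>: residuals are orthogonal to
    \<open>fs\<close>, which is what clears the lower left block.\<close>
  have FP: "F\<^sup>T * P = F\<^sup>T"
    using transpose_mult[OF P c(3)] PT PF by simp
  let ?G = "four_block_mat (X\<^sup>T * Y) (X\<^sup>T * F) (F\<^sup>T * Y) (F\<^sup>T * F)"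
  \<comment> \<open>The column operation that replaces \<open>Y\<close> by
    \<open>Y - F * (Z * Y)\<close>, that is, by \<open>Y - P * Y\<close>; it has determinant
    1.\<close>
  let ?L = "four_block_mat (1\<^sub>m r) (0\<^sub>m r m) (- (Z * Y)) (1\<^sub>m m)"
  have cG: "?G \<in> carrier_mat (r + m) (r + m)" and cL: "?L \<in> carrier_mat (r + m) (r + m)"
    using c Z by auto
  have dL: "det ?L = 1"
    by (subst det_four_block_mat_upper_right_zero[of _ r _ m]) (use Z c in auto)
  have "(mat_of_cols n (xs @ fs))\<^sup>T * mat_of_cols n (ys @ fs) = ?G"
    by (rule eq_matI) (use len xs ys fs in \<open>auto simp: X_def Y_def F_def r_def m_def nth_append
      col_mat_of_cols[OF _ subsetD[OF _ nth_mem]]\<close>)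
  then have "wedge_inner (xs @ fs) (ys @ fs) = det ?G"
    using wedge_inner_mat_of_cols[of "xs @ fs" n "ys @ fs"] xs ys fs by simp
  also have "\<dots> = det (?G * ?L)"
    by (simp add: det_mult[OF cG cL] dL)
  also have "?G * ?L = four_block_mat (X\<^sup>T * Y + X\<^sup>T * F * - (Z * Y)) (X\<^sup>T * F)
      (F\<^sup>T * Y + F\<^sup>T * F * - (Z * Y)) (F\<^sup>T * F)"
    by (subst mult_four_block_mat[of _ r r _ m _ m _ _ r _ m]) (use c Z in auto)
  also have "F\<^sup>T * Y + F\<^sup>T * F * - (Z * Y) = 0\<^sub>m m r"
  proof -
    have "F\<^sup>T * F * (Z * Y) = F\<^sup>T * (F * Z) * Y"
      using c Z assoc_mult_mat[of "F\<^sup>T * F" m m Z n Y r] assoc_mult_mat[of "F\<^sup>T" m n F m Z n]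
      by simp
    also have "\<dots> = F\<^sup>T * Y" using FP PZ by simp
    finally have "F\<^sup>T * F * - (Z * Y) = - (F\<^sup>T * Y)"
      using c Z by (subst uminus_mult_right_mat) auto
    then show ?thesis using c by (auto intro!: eq_matI)
  qed
  also have "X\<^sup>T * Y + X\<^sup>T * F * - (Z * Y) = mat (length xs) (length ys) (\<lambda>(s, t). xs ! s \<bullet> ys ! t - xs ! s \<bullet> (P *\<^sub>v ys ! t))"
  proof -
    have XFZ: "X\<^sup>T * F * (Z * Y) = X\<^sup>T * (P * Y)"
      using c Z assoc_mult_mat[of "X\<^sup>T" r n F m "Z * Y" r] assoc_mult_mat[of F n m Z n Y r] PZ by simp
    have "X\<^sup>T * F * - (Z * Y) = - (X\<^sup>T * (P * Y))"
      using c Z by (subst uminus_mult_right_mat) (auto simp: XFZ)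
    moreover have "col X s = xs ! s" if "s < r" for s
      using that xs len by (simp add: X_def r_def col_mat_of_cols[OF _ subsetD[OF _ nth_mem]])
    moreover have "col Y s = ys ! s" if "s < r" for s
      using that ys len by (simp add: Y_def r_def col_mat_of_cols[OF _ subsetD[OF _ nth_mem]])
    ultimately show ?thesis
      using c P len by (auto intro!: eq_matI simp: r_def mult_mat_vec_def)
  qed
  also have "det (four_block_mat \<dots> (X\<^sup>T * F) (0\<^sub>m m r) (F\<^sup>T * F)) = det \<dots> * det (F\<^sup>T * F)"
    by (rule det_four_block_mat_lower_left_zero[of _ r _ m]) (use c len in \<open>auto simp: r_def\<close>)
  also have "det (F\<^sup>T * F) = wedge_inner fs fs"
    using wedge_inner_mat_of_cols[OF fs fs] by (simp add: F_def)
  finally show ?thesis by simp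
qed

text \<open>Only the components orthogonal to the span of \<open>fs\<close> survive in a wedge with
  all of \<open>fs\<close>: the entries of the Schur complement are the inner products of
  residuals.\<close>

lemma wedge_inner_append:
  assumes xs: "set xs \<subseteq> carrier_vec n" and ys: "set ys \<subseteq> carrier_vec n"
    and len: "length xs = length ys"
  shows "wedge_inner (xs @ fs) (ys @ fs) = wedge_inner fs fs *
    wedge_inner (map (\<lambda>x. x - P *\<^sub>v x) xs) (map (\<lambda>x. x - P *\<^sub>v x) ys)"
proof -
  have "mat (length xs) (length ys) (\<lambda>(s, t). xs ! s \<bullet> ys ! t - xs ! s \<bullet> (P *\<^sub>v ys ! t))
    = mat (length xs) (length ys) (\<lambda>(s, t). (xs ! s - P *\<^sub>v xs ! s) \<bullet> (ys ! t - P *\<^sub>v ys ! t))"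
    by (rule eq_matI) (use inner_residual subsetD[OF xs nth_mem] subsetD[OF ys nth_mem] in auto)
  also have "det \<dots> = wedge_inner (map (\<lambda>x. x - P *\<^sub>v x) xs) (map (\<lambda>x. x - P *\<^sub>v x) ys)"
    unfolding wedge_inner_def by (rule arg_cong[of _ _ det]) (rule eq_matI, auto)
  finally show ?thesis
    using wedge_inner_append_det[OF xs ys len] by simp
qed

lemma wedge_inner_Cons:
  assumes "x \<in> carrier_vec n" "y \<in> carrier_vec n"
  shows "wedge_inner (x # fs) (y # fs) = wedge_inner fs fs * (x \<bullet> y - x \<bullet> (P *\<^sub>v y))"
  using wedge_inner_append[of "[x]" "[y]"] assms by (simp add: wedge_inner_1 inner_residual)

lemma wedge_inner_Cons2:
  assumes "x \<in> carrier_vec n" "y \<in> carrier_vec n"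
  shows "wedge_inner (x # y # fs) (x # y # fs) = wedge_inner fs fs *
    ((x \<bullet> x - x \<bullet> (P *\<^sub>v x)) * (y \<bullet> y - y \<bullet> (P *\<^sub>v y)) - (x \<bullet> y - x \<bullet> (P *\<^sub>v y))\<^sup>2)"
  using wedge_inner_append[of "[x, y]" "[x, y]"] assms comm_scalar_prod[OF assms]
  by (simp add: wedge_inner_2 inner_residual inner_commute power2_eq_square)

text \<open>Split every inner product into a projected part \<open>v\<close> and a residual part
  \<open>w\<close>. Each first-order difference is then \<open>v + (1 - \<kappa>) * w\<close>; in
  the expansion the products of a diagonal \<open>v\<close> with a diagonal \<open>w\<close> and of
  the two diagonal \<open>w\<close> cancel, while the product of the two diagonal \<open>v\<close>
  keeps the factor \<open>\<kappa>\<close>. The vectors are arbitrary, so residuals may stand in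
  place of columns.\<close>

lemma correlation_identity:
  fixes x y
  assumes "x \<in> carrier_vec n" "y \<in> carrier_vec n"
  defines "\<kappa> \<equiv> wedge_inner fs fs"
  shows "(x \<bullet> x - wedge_inner (x # fs) (x # fs)) * (y \<bullet> y - wedge_inner (y # fs) (y # fs))
    - (wedge_inner [x, y] [x, y] - wedge_inner (x # y # fs) (x # y # fs)) * (1 - \<kappa>)
    = (x \<bullet> (P *\<^sub>v y) + (1 - \<kappa>) * (x \<bullet> y - x \<bullet> (P *\<^sub>v y)))\<^sup>2
      + \<kappa> * ((x \<bullet> (P *\<^sub>v x)) * (y \<bullet> (P *\<^sub>v y)) - (x \<bullet> (P *\<^sub>v y))\<^sup>2)"
  unfolding wedge_inner_Cons[OF assms(1,1)] wedge_inner_Cons[OF assms(2,2)]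
    wedge_inner_Cons2[OF assms(1,2)] wedge_inner_2 comm_scalar_prod[OF assms(2,1)] \<kappa>_def[symmetric]
  by (simp add: power2_eq_square algebra_simps)

text \<open>Cauchy-Schwarz for the projected vectors; it gives the factor of \<open>\<kappa>\<close>
  in the correlation identity its sign.\<close>

lemma projection_Cauchy_Schwarz:
  assumes "x \<in> carrier_vec n" "y \<in> carrier_vec n"
  shows "(x \<bullet> (P *\<^sub>v y))\<^sup>2 \<le> (x \<bullet> (P *\<^sub>v x)) * (y \<bullet> (P *\<^sub>v y))"
  using scalar_prod_Cauchy_Schwarz[OF in_carrier in_carrier, of x y] assms
  by (simp add: inner_projection)

end

text \<open>The nonzero Gram determinant provides the inverse \<open>H\<close> of
  \<open>F\<^sup>T * F\<close>, and the projection is \<open>F * H * F\<^sup>T\<close>.\<close>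

lemma span_projection_exists:
  assumes fs: "set fs \<subseteq> carrier_vec n" and nz: "wedge_inner fs fs \<noteq> 0"
  obtains P Z where "span_projection n fs P Z"
proof -
  define m where "m = length fs"
  define F where "F = mat_of_cols n fs"
  have F: "F \<in> carrier_mat n m" by (auto simp: F_def m_def)
  define G where "G = F\<^sup>T * F"
  have G: "G \<in> carrier_mat m m" using F by (simp add: G_def)
  have GT: "G\<^sup>T = G" using F by (simp add: G_def transpose_mult[of _ _ n])
  have "det G \<noteq> 0" using nz wedge_inner_mat_of_cols[OF fs fs] by (simp add: G_def F_def)
  from det_non_zero_imp_unit[OF G this] obtain H where
    H: "H \<in> carrier_mat m m" "H * G = 1\<^sub>m m" "G * H = 1\<^sub>m m"
    by (auto simp: Units_def ring_mat_def)
  \<comment> \<open>The transpose of \<open>H\<close> is also a left inverse of the symmetric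
    \<open>G\<close>, hence equal to \<open>H\<close>; this makes the projection symmetric.\<close>
  have HT: "H\<^sup>T = H"
  proof -
    have "H\<^sup>T * G = 1\<^sub>m m" using transpose_mult[OF G H(1)] H GT by simp
    then have "H\<^sup>T * G * H = H" using H by simp
    then show ?thesis using assoc_mult_mat[OF transpose_carrier_mat[THEN iffD2, OF H(1)] G H(1)] H by simp
  qed
  define Z where "Z = H * F\<^sup>T"
  have Z: "Z \<in> carrier_mat m n" using H F by (simp add: Z_def)
  have ZF: "Z * F = 1\<^sub>m m"
    using assoc_mult_mat[of H m m "F\<^sup>T" n F m] H F by (simp add: Z_def G_def)
  have P: "F * Z \<in> carrier_mat n n" using F Z by simp
  have PF: "F * Z * F = F" using assoc_mult_mat[OF F Z F] ZF F by simp
  have "(F * Z)\<^sup>T = F * Z"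
    using F H(1) HT transpose_mult[of F n m "H * F\<^sup>T" n] transpose_mult[of H m m "F\<^sup>T" n]
      assoc_mult_mat[of F n m H m "F\<^sup>T" n] by (simp add: Z_def)
  then have "span_projection n fs (F * Z) Z"
    using P PF Z fs by unfold_locales (simp_all add: F_def m_def)
  then show thesis by (rule that)
qed

text \<open>The right side of the correlation identity is a square plus \<open>\<kappa>\<close>
  times a nonnegative quantity. If the Gram determinant of \<open>cs\<close> is 0, the claim reduces
  to \<open>(x \<bullet> y)\<^sup>2\<close> being nonnegative. In the application
  \<open>nonneg\<close> and \<open>degenerate\<close> come from probabilities being nonnegative and
  monotone.\<close>

lemma wedge_negative_correlation:
  assumes x: "x \<in> carrier_vec n" and y: "y \<in> carrier_vec n" and cs: "set cs \<subseteq> carrier_vec n"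
    and nonneg: "wedge_inner cs cs \<ge> 0"
    and degenerate: "wedge_inner cs cs = 0 \<Longrightarrow> wedge_inner (x # cs) (x # cs) = 0 \<and>
      wedge_inner (y # cs) (y # cs) = 0 \<and> wedge_inner (x # y # cs) (x # y # cs) = 0"
  shows "(wedge_inner [x, y] [x, y] - wedge_inner (x # y # cs) (x # y # cs)) * (1 - wedge_inner cs cs)
    \<le> (wedge_inner [x] [x] - wedge_inner (x # cs) (x # cs)) * (wedge_inner [y] [y] - wedge_inner (y # cs) (y # cs))"
proof (cases "wedge_inner cs cs = 0")
  case True
  then show ?thesis
    using degenerate comm_scalar_prod[OF x y] by (simp add: wedge_inner_1 wedge_inner_2)
next
  case False
  obtain P Z where "span_projection n cs P Z" using span_projection_exists[OF cs False] .
  then interpret span_projection n cs P Z .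
  show ?thesis
    using correlation_identity[OF x y] projection_Cauchy_Schwarz[OF x y] nonneg
    by (smt (verit) mult_nonneg_nonneg wedge_inner_1 zero_le_power2)
qed

subsection \<open>Inclusion probabilities of the determinantal process\<close>

text \<open>Sylvester's identity. Multiplying \<open>?N\<close> by the unipotent \<open>?L\<close>
  on the right or on the left makes it block upper triangular, with one of the two matrices as a
  diagonal block and an identity as the other.\<close>

lemma det_one_plus_mult_commute:
  fixes X Y :: "'a :: idom mat"
  assumes X: "X \<in> carrier_mat n m" and Y: "Y \<in> carrier_mat m n"
  shows "det (1\<^sub>m n + X * Y) = det (1\<^sub>m m + Y * X)"
proof -
  let ?N = "four_block_mat (1\<^sub>m n) (- X) Y (1\<^sub>m m)"
  let ?L = "four_block_mat (1\<^sub>m n) (0\<^sub>m n m) (- Y) (1\<^sub>m m)"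
  have cN: "?N \<in> carrier_mat (n + m) (n + m)" and cL: "?L \<in> carrier_mat (n + m) (n + m)"
    using X Y by auto
  have dL: "det ?L = 1"
    by (subst det_four_block_mat_upper_right_zero[of _ n _ m]) (use Y in auto)
  have XY: "- X * - Y = X * Y"
    by (rule eq_matI) (use X Y in \<open>auto simp: scalar_prod_def\<close>)
  have YX: "- Y * - X = Y * X"
    by (rule eq_matI) (use X Y in \<open>auto simp: scalar_prod_def\<close>)
  have z: "Y + - Y = 0\<^sub>m m n" "- Y + Y = 0\<^sub>m m n"
    by (rule eq_matI; use Y in auto)+
  have "?N * ?L = four_block_mat (1\<^sub>m n + X * Y) (- X) (0\<^sub>m m n) (1\<^sub>m m)"
    by (subst mult_four_block_mat[of _ n n _ m _ m _ _ n _ m]) (use X Y z in \<open>auto simp: XY\<close>)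
  then have "det ?N * det ?L = det (1\<^sub>m n + X * Y)"
    unfolding det_mult[OF cN cL, symmetric]
    by simp (subst det_four_block_mat_lower_left_zero[of _ n _ m], use X Y in auto)
  moreover have "?L * ?N = four_block_mat (1\<^sub>m n) (- X) (0\<^sub>m m n) (1\<^sub>m m + Y * X)"
    by (subst mult_four_block_mat[of _ n n _ m _ m _ _ n _ m])
      (use X Y z in \<open>auto simp: YX comm_add_mat\<close>)
  then have "det ?L * det ?N = det (1\<^sub>m m + Y * X)"
    unfolding det_mult[OF cL cN, symmetric]
    by simp (subst det_four_block_mat_lower_left_zero[of _ n _ m], use X Y in auto)
  ultimately show ?thesis by (simp add: dL)
qed

section \<open>Normalization of the law and probabilities as finite sums\<close>

lemma orthonormal_rows_inner:
  assumes M: "M \<in> carrier_mat p n" and orth: "orthonormal n (rows M)" and ij: "i < p" "j < p"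
  shows "(\<Sum>k<n. M $$ (i, k) * M $$ (j, k)) = (if i = j then 1 else 0)"
proof -
  have "rows M ! i \<bullet> rows M ! j = (if i = j then 1 else 0)"
    using orth ij M by (auto simp: orthonormal_def)
  then show ?thesis using M ij by (simp add: scalar_prod_def lessThan_atLeast0)
qed

lemma sum_det_squared_eq_1:
  assumes M: "M \<in> carrier_mat p n" and orth: "orthonormal n (rows M)"
  shows "(\<Sum>S | S \<subseteq> {..<n} \<and> card S = p. (det (submatrix M UNIV S))\<^sup>2) = 1"
proof -
  have "mat p p (\<lambda>(i, j). \<Sum>k<n. 1 * M $$ (i, k) * M $$ (j, k)) = 1\<^sub>m p"
    by (rule eq_matI) (use orthonormal_rows_inner[OF M orth] in auto)
  then show ?thesis using cauchy_binet_weighted[OF M, of "\<lambda>_. 1"] by simp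
qed

lemma pmf_det_process:
  assumes M: "M \<in> carrier_mat p n" and orth: "orthonormal n (rows M)"
  shows "pmf (det_process M) S =
    (if S \<subseteq> {..<n} \<and> card S = p then (det (submatrix M UNIV S))\<^sup>2 else 0)"
proof -
  let ?f = "\<lambda>S. if S \<subseteq> {..<n} \<and> card S = p then (det (submatrix M UNIV S))\<^sup>2 else 0"
  let ?P = "{S. S \<subseteq> {..<n} \<and> card S = p}"
  have fin: "finite ?P" by (rule finite_subset[of _ "Pow {..<n}"]) auto
  have "(\<integral>\<^sup>+ S. ennreal (?f S) \<partial>count_space UNIV) = (\<Sum>S\<in>?P. ennreal (?f S))"
    by (rule nn_integral_count_space'[OF fin]) auto
  also have "\<dots> = ennreal (\<Sum>S\<in>?P. ?f S)" by (rule sum_ennreal) auto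
  also have "(\<Sum>S\<in>?P. ?f S) = 1" using sum_det_squared_eq_1[OF M orth] by simp
  finally have "(\<integral>\<^sup>+ S. ennreal (?f S) \<partial>count_space UNIV) = 1" by simp
  then have "pmf (embed_pmf ?f) S = ?f S" by (intro pmf_embed_pmf) auto
  then show ?thesis using M by (simp add: det_process_def)
qed

lemma prob_det_process:
  assumes M: "M \<in> carrier_mat p n" and orth: "orthonormal n (rows M)"
  shows "\<P>(S in det_process M. Q S) =
    (\<Sum>S | S \<subseteq> {..<n} \<and> card S = p. if Q S then (det (submatrix M UNIV S))\<^sup>2 else 0)"
proof -
  let ?P = "{S. S \<subseteq> {..<n} \<and> card S = p}"
  have fin: "finite ?P" by (rule finite_subset[of _ "Pow {..<n}"]) auto
  \<comment> \<open>Intersecting with the support replaces the event by a finite collection of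
    sets.\<close>
  have "\<P>(S in det_process M. Q S) = measure_pmf.prob (det_process M) ({S. Q S} \<inter> set_pmf (det_process M))"
    by (simp add: measure_Int_set_pmf)
  also have "{S. Q S} \<inter> set_pmf (det_process M) = {S \<in> ?P. Q S} \<inter> set_pmf (det_process M)"
    by (auto simp: set_pmf_iff pmf_det_process[OF M orth] split: if_splits)
  also have "measure_pmf.prob (det_process M) \<dots> = measure_pmf.prob (det_process M) {S \<in> ?P. Q S}"
    by (rule measure_Int_set_pmf)
  also have "\<dots> = (\<Sum>S\<in>{S \<in> ?P. Q S}. pmf (det_process M) S)"
    by (rule measure_measure_pmf_finite) (use fin in auto)
  also have "\<dots> = (\<Sum>S\<in>?P. if Q S then pmf (det_process M) S else 0)"
    by (rule sum.inter_filter[OF fin])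
  also have "\<dots> = (\<Sum>S\<in>?P. if Q S then (det (submatrix M UNIV S))\<^sup>2 else 0)"
    by (rule sum.cong) (auto simp: pmf_det_process[OF M orth])
  finally show ?thesis .
qed

text \<open>Carries an identity proved by dividing by \<open>r\<close> over to the excluded point
  0.\<close>

lemma continuous_eq_at_0:
  fixes f g :: "real \<Rightarrow> real"
  assumes "isCont f 0" "isCont g 0" "\<And>r. r \<noteq> 0 \<Longrightarrow> f r = g r"
  shows "f 0 = g 0"
proof -
  have "f \<midarrow>0\<rightarrow> f 0" "g \<midarrow>0\<rightarrow> g 0" using assms by (auto simp: isCont_def)
  moreover have "f \<midarrow>0\<rightarrow> g 0 \<longleftrightarrow> g \<midarrow>0\<rightarrow> g 0" by (rule LIM_cong) (use assms in auto)
  ultimately show ?thesis using LIM_unique by blast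
qed

text \<open>By Cauchy--Binet with weights \<open>1 + 1/r\<close> on the given columns, \<open>r\<^sup>b det (1 + K / r)\<close>
  is a polynomial in \<open>r\<close> whose value at 0 is both sides of the claim.\<close>

theorem prob_det_process_superset:
  assumes M: "M \<in> carrier_mat p n" and orth: "orthonormal n (rows M)"
    and bs: "distinct bs" "set bs \<subseteq> {..<n}"
  shows "\<P>(S in det_process M. set bs \<subseteq> S) = wedge_inner (map (col M) bs) (map (col M) bs)"
proof -
  let ?P = "{S. S \<subseteq> {..<n} \<and> card S = p}"
  define b where "b = length bs"
  define X where "X = mat_of_cols p (map (col M) bs)"
  define K where "K = X\<^sup>T * X"
  define D where "D = (\<lambda>S. (det (submatrix M UNIV S))\<^sup>2)"
  have X: "X \<in> carrier_mat p b" by (auto simp: X_def b_def)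
  have K: "K \<in> carrier_mat b b" using X by (auto simp: K_def)
  have cb: "card (set bs) = b" using bs by (simp add: b_def distinct_card)
  have c_le: "card (S \<inter> set bs) \<le> b" for S
    unfolding cb[symmetric] by (rule card_mono) auto
  \<comment> \<open>This is \<open>r ^ b\<close> times the weighted sum with denominators cleared:
    each element of \<open>bs\<close> that lies in \<open>S\<close> turns a factor \<open>r\<close>
    into \<open>r + 1\<close>. At 0 only the sets containing \<open>bs\<close> remain, with factor
    1.\<close>
  define f where "f = (\<lambda>r :: real. \<Sum>S\<in>?P. D S * ((r + 1) ^ card (S \<inter> set bs) * r ^ (b - card (S \<inter> set bs))))"
  define g where "g = (\<lambda>r :: real. det (r \<cdot>\<^sub>m 1\<^sub>m b + K))"
  have "f r = g r" if r: "r \<noteq> 0" for r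
  proof -
    define d where "d = (\<lambda>k. 1 + (if k \<in> set bs then 1 / r else 0))"
    have idx: "bs ! l < n" if "l < b" for l using that bs nth_mem[of l bs] unfolding b_def by blast
    have Xi: "X $$ (i, l) = M $$ (i, bs ! l)" if "i < p" "l < b" for i l
      using that M idx by (simp add: X_def b_def mat_of_cols_def)
    \<comment> \<open>Orthonormality turns the constant part of the weights into the identity
      matrix; the columns in \<open>bs\<close> contribute \<open>X * X\<^sup>T\<close> divided by
      \<open>r\<close>.\<close>
    have "mat p p (\<lambda>(i, j). \<Sum>k<n. d k * M $$ (i, k) * M $$ (j, k)) = 1\<^sub>m p + ((1 / r) \<cdot>\<^sub>m X) * X\<^sup>T"
    proof (rule eq_matI)
      fix i j assume "i < dim_row (1\<^sub>m p + ((1 / r) \<cdot>\<^sub>m X) * X\<^sup>T)" "j < dim_col (1\<^sub>m p + ((1 / r) \<cdot>\<^sub>m X) * X\<^sup>T)"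
      then have ij: "i < p" "j < p" using X by auto
      have "(\<Sum>k<n. d k * M $$ (i, k) * M $$ (j, k)) = (\<Sum>k<n. M $$ (i, k) * M $$ (j, k))
        + (\<Sum>k<n. if k \<in> set bs then 1 / r * M $$ (i, k) * M $$ (j, k) else 0)"
        unfolding sum.distrib[symmetric]
        by (rule sum.cong) (auto simp: d_def algebra_simps)
      also have "(\<Sum>k<n. if k \<in> set bs then 1 / r * M $$ (i, k) * M $$ (j, k) else 0)
        = (\<Sum>k\<in>{k \<in> {..<n}. k \<in> set bs}. 1 / r * M $$ (i, k) * M $$ (j, k))"
        by (rule sum.inter_filter[symmetric]) auto
      also have "{k \<in> {..<n}. k \<in> set bs} = set bs" using bs by auto
      also have "(\<Sum>k\<in>set bs. 1 / r * M $$ (i, k) * M $$ (j, k))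
        = (\<Sum>l\<in>{0..<b}. 1 / r * M $$ (i, bs ! l) * M $$ (j, bs ! l))"
        by (rule sum.reindex_bij_betw[symmetric])
          (use bij_betw_nth[OF bs(1)] in \<open>simp add: b_def lessThan_atLeast0\<close>)
      finally show "mat p p (\<lambda>(i, j). \<Sum>k<n. d k * M $$ (i, k) * M $$ (j, k)) $$ (i, j)
        = (1\<^sub>m p + ((1 / r) \<cdot>\<^sub>m X) * X\<^sup>T) $$ (i, j)"
        using ij X Xi orthonormal_rows_inner[OF M orth ij] by (simp add: scalar_prod_def)
    qed (use X in auto)
    then have "(\<Sum>S\<in>?P. D S * (\<Prod>k\<in>S. d k)) = det (1\<^sub>m p + ((1 / r) \<cdot>\<^sub>m X) * X\<^sup>T)"
      using cauchy_binet_weighted[OF M, of d] by (simp add: D_def)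
    \<comment> \<open>Sylvester's identity passes from size \<open>p\<close> to size
      \<open>b\<close>, where the factor \<open>r ^ b\<close> amounts to scaling the matrix by
      \<open>r\<close>.\<close>
    also have "\<dots> = det (1\<^sub>m b + X\<^sup>T * ((1 / r) \<cdot>\<^sub>m X))"
      by (rule det_one_plus_mult_commute) (use X in auto)
    finally have "r ^ b * (\<Sum>S\<in>?P. D S * (\<Prod>k\<in>S. d k)) = det (r \<cdot>\<^sub>m (1\<^sub>m b + X\<^sup>T * ((1 / r) \<cdot>\<^sub>m X)))"
      using X by (simp add: det_smult)
    also have "r \<cdot>\<^sub>m (1\<^sub>m b + X\<^sup>T * ((1 / r) \<cdot>\<^sub>m X)) = r \<cdot>\<^sub>m 1\<^sub>m b + K"
      by (rule eq_matI) (use X r in \<open>auto simp: K_def algebra_simps\<close>)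
    also have "r ^ b * (\<Sum>S\<in>?P. D S * (\<Prod>k\<in>S. d k)) = f r"
      unfolding f_def sum_distrib_left
    proof (rule sum.cong[OF refl])
      fix S assume "S \<in> ?P"
      then have finS: "finite S" by (auto intro: finite_subset)
      have "(\<Prod>k\<in>S. d k) = (\<Prod>k\<in>S \<inter> set bs. 1 + 1 / r)"
        using finS by (intro prod.mono_neutral_cong_right) (auto simp: d_def)
      then have "r ^ b * (\<Prod>k\<in>S. d k) = r ^ (card (S \<inter> set bs) + (b - card (S \<inter> set bs))) * (1 + 1 / r) ^ card (S \<inter> set bs)"
        using c_le by simp
      also have "\<dots> = (r * (1 + 1 / r)) ^ card (S \<inter> set bs) * r ^ (b - card (S \<inter> set bs))"
        by (simp only: power_add power_mult_distrib ac_simps)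
      also have "r * (1 + 1 / r) = r + 1" using r by (simp add: field_simps)
      finally show "r ^ b * (D S * (\<Prod>k\<in>S. d k)) = D S * ((r + 1) ^ card (S \<inter> set bs) * r ^ (b - card (S \<inter> set bs)))"
        by (metis mult.left_commute)
    qed
    finally show ?thesis by (simp add: g_def)
  qed
  moreover have "isCont f 0" unfolding f_def by (intro continuous_intros)
  moreover have "isCont g 0"
  proof -
    \<comment> \<open>The Leibniz expansion shows that \<open>g\<close> is a polynomial in
      \<open>r\<close>, hence continuous.\<close>
    have "g = (\<lambda>r. \<Sum>\<pi> | \<pi> permutes {0..<b}. signof \<pi> * (\<Prod>i=0..<b. r * of_bool (i = \<pi> i) + K $$ (i, \<pi> i)))"
      unfolding g_def using K by (subst det_def'[of _ b])
        (auto simp: fun_eq_iff permutes_in_image intro!: sum.cong prod.cong)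
    moreover have "isCont \<dots> 0"
      by (intro continuous_intros)
    ultimately show ?thesis by simp
  qed
  ultimately have "f 0 = g 0" using continuous_eq_at_0[of f g] by blast
  moreover have "g 0 = wedge_inner (map (col M) bs) (map (col M) bs)"
  proof -
    have "0 \<cdot>\<^sub>m 1\<^sub>m b + K = K" using K by (auto intro!: eq_matI)
    moreover have "set (map (col M) bs) \<subseteq> carrier_vec p" using M by auto
    ultimately show ?thesis by (simp add: g_def K_def X_def wedge_inner_mat_of_cols)
  qed
  moreover have "f 0 = \<P>(S in det_process M. set bs \<subseteq> S)"
    unfolding prob_det_process[OF M orth] f_def
  proof (rule sum.cong[OF refl])
    fix S
    \<comment> \<open>With \<open>0 ^ 0 = 1\<close>, the power of 0 is the indicator of this
      condition. Truncated subtraction yields only an inequality of cardinalities, which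
      \<open>c_le\<close> makes an equality.\<close>
    have "b - card (S \<inter> set bs) = 0 \<longleftrightarrow> set bs \<subseteq> S"
    proof
      assume "b - card (S \<inter> set bs) = 0"
      then have "card (S \<inter> set bs) = card (set bs)" using c_le[of S] cb by simp
      then have "S \<inter> set bs = set bs" by (intro card_subset_eq) auto
      then show "set bs \<subseteq> S" by auto
    qed (use cb in \<open>simp add: Int_absorb1\<close>)
    then show "D S * ((0 + 1) ^ card (S \<inter> set bs) * 0 ^ (b - card (S \<inter> set bs)))
      = (if set bs \<subseteq> S then (det (submatrix M UNIV S))\<^sup>2 else 0)"
      by (simp add: D_def power_0_left)
  qed
  ultimately show ?thesis by simp
qed

subsection \<open>Negative correlation\<close>

lemma prob_superset_diff:
  fixes D :: "'a set pmf"
  shows "\<P>(S in D. A \<subseteq> S \<and> \<not> C \<subseteq> S) = \<P>(S in D. A \<subseteq> S) - \<P>(S in D. A \<union> C \<subseteq> S)"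
proof -
  have "{S. A \<subseteq> S \<and> \<not> C \<subseteq> S} = {S. A \<subseteq> S} - {S. A \<union> C \<subseteq> S}" by auto
  moreover have "{S. A \<union> C \<subseteq> S} \<subseteq> {S. A \<subseteq> S}" by auto
  ultimately show ?thesis by (simp add: measure_pmf.finite_measure_Diff)
qed

text \<open>The ratio \<open>h (insert i G) / h G\<close> does not increase as the elements of
  \<open>B\<close> are added to \<open>G = F\<close>, written without division to allow zeros. The
  induction step multiplies the local inequality by the induction hypothesis and cancels
  \<open>h (F \<union> B)\<close>; if that is 0, so is every value on a larger set.\<close>

lemma log_submodular_insert:
  fixes h :: "'a set \<Rightarrow> real"
  assumes nonneg: "\<And>F. h F \<ge> 0" and anti: "\<And>F G. F \<subseteq> G \<Longrightarrow> h G \<le> h F"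
    and loc: "\<And>F i j. F \<subseteq> U \<Longrightarrow> i \<in> U - F \<Longrightarrow> j \<in> U - F \<Longrightarrow> i \<noteq> j \<Longrightarrow>
      h (insert i (insert j F)) * h F \<le> h (insert i F) * h (insert j F)"
    and "finite B" "B \<subseteq> U" "F \<subseteq> U" "B \<inter> F = {}" "i \<in> U - (F \<union> B)"
  shows "h (insert i (F \<union> B)) * h F \<le> h (insert i F) * h (F \<union> B)"
  using assms(4-)
proof (induction B rule: finite_induct)
  case empty
  then show ?case by simp
next
  case (insert j B)
  let ?G = "F \<union> B"
  have IH: "h (insert i ?G) * h F \<le> h (insert i F) * h ?G" using insert by auto
  have l: "h (insert i (insert j ?G)) * h ?G \<le> h (insert i ?G) * h (insert j ?G)"
    by (rule loc) (use insert in auto)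
  show ?case
  proof (cases "h ?G = 0")
    case True
    then have "h (insert i (insert j ?G)) = 0"
      using anti[of ?G "insert i (insert j ?G)"] nonneg[of "insert i (insert j ?G)"] by auto
    then show ?thesis using nonneg by simp
  next
    case False
    then have pos: "h ?G > 0" using nonneg[of ?G] by simp
    have "h (insert i (insert j ?G)) * h F * h ?G \<le> h (insert i ?G) * h F * h (insert j ?G)"
      using mult_right_mono[OF l nonneg[of F]] by (simp add: ac_simps)
    also have "\<dots> \<le> h (insert i F) * h (insert j ?G) * h ?G"
      using mult_right_mono[OF IH nonneg[of "insert j ?G"]] by (simp add: ac_simps)
    finally show ?thesis using pos by simp
  qed
qed

text \<open>The same telescoping in the other set: \<open>A\<close> is built up one element at a
  time, and \<open>log_submodular_insert\<close> compares adding \<open>i\<close> to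
  \<open>A\<close> with adding it to \<open>A \<union> B\<close>.\<close>

lemma log_submodular_disjoint:
  fixes h :: "'a set \<Rightarrow> real"
  assumes nonneg: "\<And>F. h F \<ge> 0" and anti: "\<And>F G. F \<subseteq> G \<Longrightarrow> h G \<le> h F"
    and loc: "\<And>F i j. F \<subseteq> U \<Longrightarrow> i \<in> U - F \<Longrightarrow> j \<in> U - F \<Longrightarrow> i \<noteq> j \<Longrightarrow>
      h (insert i (insert j F)) * h F \<le> h (insert i F) * h (insert j F)"
    and "finite A" "finite B" "A \<subseteq> U" "B \<subseteq> U" "A \<inter> B = {}"
  shows "h (A \<union> B) * h {} \<le> h A * h B"
  using assms(4-)
proof (induction A rule: finite_induct)
  case empty
  then show ?case by simp
next
  case (insert i A)
  have IH: "h (A \<union> B) * h {} \<le> h A * h B" using insert by auto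
  have l: "h (insert i (A \<union> B)) * h A \<le> h (insert i A) * h (A \<union> B)"
    by (rule log_submodular_insert[OF nonneg anti loc]) (use insert in auto)
  show ?case
  proof (cases "h A = 0")
    case True
    then have "h (insert i (A \<union> B)) = 0"
      using anti[of A "insert i (A \<union> B)"] nonneg[of "insert i (A \<union> B)"] by auto
    then show ?thesis using nonneg by simp
  next
    case False
    then have pos: "h A > 0" using nonneg[of A] by simp
    have "h (insert i (A \<union> B)) * h {} * h A \<le> h (insert i A) * h {} * h (A \<union> B)"
      using mult_right_mono[OF l nonneg[of "{}"]] by (simp add: ac_simps)
    also have "\<dots> \<le> h (insert i A) * h B * h A"
      using mult_right_mono[OF IH nonneg[of "insert i A"]] by (simp add: ac_simps)
    finally show ?thesis using pos by simp
  qed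
qed

text \<open>Requiring \<open>F \<subseteq> S\<close> replaces the columns by their residuals modulo
  the columns in \<open>F\<close>: up to the factor \<open>g F\<close>, inclusion probabilities of
  sets containing \<open>F\<close> are Gram determinants of residuals. The values of
  \<open>h\<close> are then the differences in \<open>wedge_negative_correlation\<close>.\<close>

lemma prob_avoiding_local:
  assumes M: "M \<in> carrier_mat p n" and orth: "orthonormal n (rows M)"
    and sub: "F \<subseteq> {..<n}" "C \<subseteq> {..<n}" "i < n" "j < n"
    and disj: "F \<inter> C = {}" "i \<notin> F" "i \<notin> C" "j \<notin> F" "j \<notin> C" "i \<noteq> j"
  defines "h \<equiv> \<lambda>F. \<P>(S in det_process M. F \<subseteq> S \<and> \<not> C \<subseteq> S)"
  shows "h (insert i (insert j F)) * h F \<le> h (insert i F) * h (insert j F)"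
proof -
  define g where "g = (\<lambda>B. \<P>(S in det_process M. B \<subseteq> S))"
  have g_anti: "g B' \<le> g B" if "B \<subseteq> B'" for B B'
    unfolding g_def by (rule measure_pmf.finite_measure_mono) (use that in auto)
  have g_nonneg: "g B \<ge> 0" for B by (simp add: g_def)
  have h: "h B = g B - g (B \<union> C)" for B
    unfolding h_def g_def by (rule prob_superset_diff)
  have h_nonneg: "h B \<ge> 0" for B by (simp add: h_def)
  obtain fs where fsF: "distinct fs" "set fs = F"
    using finite_distinct_list[OF finite_subset[OF sub(1) finite_lessThan]] by blast
  obtain cs where cs: "distinct cs" "set cs = C"
    using finite_distinct_list[OF finite_subset[OF sub(2) finite_lessThan]] by blast
  define G where "G = map (col M) fs"
  have Gc: "set G \<subseteq> carrier_vec p" using M by (auto simp: G_def)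
  have gF: "g F = wedge_inner G G"
    unfolding g_def G_def fsF(2)[symmetric]
    by (rule prob_det_process_superset[OF M orth]) (use fsF sub in auto)
  show ?thesis
  proof (cases "g F = 0")
    case True
    then have "h F = 0" using h[of F] h_nonneg[of F] g_nonneg[of "F \<union> C"] by simp
    then show ?thesis using h_nonneg by simp
  next
    case False
    have "wedge_inner G G \<noteq> 0" using False gF by simp
    then obtain P Z where "span_projection p G P Z"
      using span_projection_exists[OF Gc] by blast
    then interpret span_projection p G P Z .
    define a where "a = (\<lambda>k. col M k - P *\<^sub>v col M k)"
    have ac: "a k \<in> carrier_vec p" for k unfolding a_def using M by (intro minus_carrier_vec in_carrier) auto
    have g: "g (set ls \<union> F) = g F * wedge_inner (map a ls) (map a ls)"
      if "distinct ls" "set ls \<inter> F = {}" "set ls \<subseteq> {..<n}" for ls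
    proof -
      have "g (set (ls @ fs)) = wedge_inner (map (col M) (ls @ fs)) (map (col M) (ls @ fs))"
        unfolding g_def by (rule prob_det_process_superset[OF M orth]) (use that fsF sub in auto)
      also have "\<dots> = g F * wedge_inner (map a ls) (map a ls)"
      proof -
        have "set (map (col M) ls) \<subseteq> carrier_vec p" using M by auto
        from wedge_inner_append[OF this this refl] show ?thesis
          by (simp add: G_def[symmetric] gF a_def o_def)
      qed
      finally show ?thesis by (simp add: fsF)
    qed
    let ?w = "\<lambda>ls. wedge_inner (map a ls) (map a ls)"
    have sets: "F \<union> C = set cs \<union> F" "insert i F \<union> C = set (i # cs) \<union> F"
      "insert j F \<union> C = set (j # cs) \<union> F" "insert i (insert j F) \<union> C = set (i # j # cs) \<union> F"
      using cs by auto
    have gC: "g (F \<union> C) = g F * ?w cs" "g (insert i F \<union> C) = g F * ?w (i # cs)"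
      "g (insert j F \<union> C) = g F * ?w (j # cs)" "g (insert i (insert j F) \<union> C) = g F * ?w (i # j # cs)"
      unfolding sets by (rule g; use cs sub disj in auto)+
    have g0: "g (insert i F) = g F * ?w [i]" "g (insert j F) = g F * ?w [j]"
      "g (insert i (insert j F)) = g F * ?w [i, j]"
      using g[of "[i]"] g[of "[j]"] g[of "[i, j]"] sub disj by auto
    have pos: "g F > 0" using False g_nonneg[of F] by simp
    have "(?w [i, j] - ?w (i # j # cs)) * (1 - ?w cs) \<le> (?w [i] - ?w (i # cs)) * (?w [j] - ?w (j # cs))"
      unfolding list.map
    proof (rule wedge_negative_correlation)
      show "0 \<le> ?w cs" using gC(1) pos g_nonneg[of "F \<union> C"] by (simp add: zero_le_mult_iff)
    next
      \<comment> \<open>If \<open>F \<union> C\<close> has inclusion probability 0, monotonicity of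
        \<open>g\<close> gives the same for every larger set.\<close>
      assume "?w cs = 0"
      then have "g (F \<union> C) = 0" using gC by simp
      then have z: "g B = 0" if "F \<union> C \<subseteq> B" for B
        using g_anti[OF that] g_nonneg[of B] by simp
      have "g (insert i F \<union> C) = 0" "g (insert j F \<union> C) = 0" "g (insert i (insert j F) \<union> C) = 0"
        by (rule z, auto)+
      then show "wedge_inner (a i # map a cs) (a i # map a cs) = 0 \<and>
        wedge_inner (a j # map a cs) (a j # map a cs) = 0 \<and>
        wedge_inner (a i # a j # map a cs) (a i # a j # map a cs) = 0"
        using gC pos by simp
    qed (use ac in auto)
    \<comment> \<open>Each value of \<open>h\<close> in the claim carries one factor
      \<open>g F\<close>.\<close>
    then have "(g F * g F) * ((?w [i, j] - ?w (i # j # cs)) * (1 - ?w cs))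
      \<le> (g F * g F) * ((?w [i] - ?w (i # cs)) * (?w [j] - ?w (j # cs)))"
      by (rule mult_left_mono) simp
    moreover have "h F = g F * (1 - ?w cs)" "h (insert i F) = g F * (?w [i] - ?w (i # cs))"
      "h (insert j F) = g F * (?w [j] - ?w (j # cs))"
      "h (insert i (insert j F)) = g F * (?w [i, j] - ?w (i # j # cs))"
      unfolding h gC g0 by (simp_all only: right_diff_distrib mult_1_right)
    ultimately show ?thesis by (simp only: ac_simps)
  qed
qed

text \<open>\<open>C\<close> is the set common to both conditions. By inclusion-exclusion all
  probabilities are combinations of values of \<open>h\<close>, and clearing denominators turns the
  claim into \<open>h (A \<union> B) * h {} \<le> h A * h B\<close>.\<close>

theorem negative_correlation_conditional:
  assumes M: "M \<in> carrier_mat p n" and orth: "orthonormal n (rows M)"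
    and sub: "A \<subseteq> {..<n}" "B \<subseteq> {..<n}" "C \<subseteq> {..<n}"
    and disj: "A \<inter> C = {}" "B \<inter> C = {}" "A \<inter> B = {}"
    and pos: "\<P>(S in det_process M. \<not> C \<subseteq> S \<and> \<not> B \<subseteq> S) > 0"
  shows "\<P>(S in det_process M. \<not> A \<subseteq> S \<bar> \<not> C \<subseteq> S \<and> \<not> B \<subseteq> S)
    \<le> \<P>(S in det_process M. \<not> A \<subseteq> S \<bar> \<not> C \<subseteq> S)"
proof -
  let ?P = "measure_pmf.prob (det_process M)"
  have fin: "finite A" "finite B" using sub by (simp_all add: finite_subset)
  define h where "h = (\<lambda>F. \<P>(S in det_process M. F \<subseteq> S \<and> \<not> C \<subseteq> S))"
  have sub_h: "h (A \<union> B) * h {} \<le> h A * h B"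
  \<comment> \<open>The points of \<open>C\<close> are removed from the universe, as the local
    inequality concerns sets and points outside \<open>C\<close>.\<close>
  proof (rule log_submodular_disjoint[where U = "{..<n} - C"])
    show "h F \<ge> 0" for F by (simp add: h_def)
    show "h G \<le> h F" if "F \<subseteq> G" for F G
      unfolding h_def by (rule measure_pmf.finite_measure_mono) (use that in auto)
    show "h (insert i (insert j F)) * h F \<le> h (insert i F) * h (insert j F)"
      if "F \<subseteq> {..<n} - C" "i \<in> {..<n} - C - F" "j \<in> {..<n} - C - F" "i \<noteq> j" for F i j
      unfolding h_def by (rule prob_avoiding_local[OF M orth]) (use that sub in auto)
  qed (use sub disj fin in auto)
  let ?h = "\<lambda>F. {S. F \<subseteq> S \<and> \<not> C \<subseteq> S}"
  have h: "?P (?h F) = h F" for F by (simp add: h_def)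
  have diff: "?P (X - Y) = ?P X - ?P Y" if "Y \<subseteq> X" for X Y
    by (rule measure_pmf.finite_measure_Diff) (use that in auto)
  have h0: "?P {S. \<not> C \<subseteq> S} = h {}" using h[of "{}"] by simp
  have eqs: "{S. \<not> C \<subseteq> S \<and> \<not> B \<subseteq> S} = ?h {} - ?h B"
    "{S. \<not> A \<subseteq> S \<and> \<not> C \<subseteq> S} = ?h {} - ?h A"
    "{S. \<not> A \<subseteq> S \<and> \<not> C \<subseteq> S \<and> \<not> B \<subseteq> S} = (?h {} - ?h A) - (?h B - ?h (A \<union> B))"
    by auto
  have hB: "?P {S. \<not> C \<subseteq> S \<and> \<not> B \<subseteq> S} = h {} - h B"
    unfolding eqs h[symmetric] by (rule diff) auto
  have hA: "?P {S. \<not> A \<subseteq> S \<and> \<not> C \<subseteq> S} = h {} - h A"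
    unfolding eqs h[symmetric] by (rule diff) auto
  have "?P (?h B - ?h (A \<union> B)) = h B - h (A \<union> B)"
    unfolding h[symmetric] by (rule diff) auto
  moreover have "?P ((?h {} - ?h A) - (?h B - ?h (A \<union> B))) = ?P (?h {} - ?h A) - ?P (?h B - ?h (A \<union> B))"
    by (rule diff) auto
  ultimately have hAB: "?P {S. \<not> A \<subseteq> S \<and> \<not> C \<subseteq> S \<and> \<not> B \<subseteq> S} = h {} - h A - (h B - h (A \<union> B))"
    using hA unfolding eqs by simp
  \<comment> \<open>Both conditioning events have positive probability, so the conditional
    probabilities are genuine quotients.\<close>
  have p1: "h {} - h B > 0" using pos hB by simp
  moreover have "h B \<ge> 0" by (simp add: h_def)
  ultimately have p0: "h {} > 0" by simp
  have "(h {} - h A - (h B - h (A \<union> B))) * h {} \<le> (h {} - h A) * (h {} - h B)"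
    using sub_h by (simp add: algebra_simps)
  then show ?thesis
    using p0 p1 by (simp add: cond_prob_def h0 hB hA hAB pos_divide_le_eq pos_le_divide_eq)
qed

subsection \<open>Conditional correlations\<close>

text \<open>All conditional probabilities have denominator \<open>1 - \<kappa>\<close>; over the
  common denominator, the square of \<open>1 - \<kappa>\<close>, the numerator is the left side of
  the correlation identity. The projection stays a parameter because the cases \<open>m = p\<close>
  and \<open>m < p\<close> insert different explicit ones.\<close>

lemma conditional_correlation:
  assumes M: "M \<in> carrier_mat p n" and orth: "orthonormal n (rows M)"
    and lst: "distinct is" "set is \<subseteq> {..<n}" and ij: "i < n" "j < n" "i \<noteq> j" "i \<notin> set is" "j \<notin> set is"
    and \<kappa>: "\<kappa> = \<P>(S in det_process M. set is \<subseteq> S)" "\<kappa> \<noteq> 1"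
    and proj: "span_projection p (map (col M) is) P Z"
  defines "x \<equiv> col M i" and "y \<equiv> col M j"
  shows "\<P>(S in det_process M. i \<in> S \<bar> \<not> set is \<subseteq> S) * \<P>(S in det_process M. j \<in> S \<bar> \<not> set is \<subseteq> S)
      - \<P>(S in det_process M. i \<in> S \<and> j \<in> S \<bar> \<not> set is \<subseteq> S)
    = (1 - \<kappa>) powi (- 2) *
      ((x \<bullet> (P *\<^sub>v y) + (1 - \<kappa>) * (x \<bullet> y - x \<bullet> (P *\<^sub>v y)))\<^sup>2
        + \<kappa> * ((x \<bullet> (P *\<^sub>v x)) * (y \<bullet> (P *\<^sub>v y)) - (x \<bullet> (P *\<^sub>v y))\<^sup>2))"
proof -
  interpret span_projection p "map (col M) is" P Z by (rule proj)
  let ?P = "measure_pmf.prob (det_process M)"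
  let ?w = "\<lambda>ls. wedge_inner (map (col M) ls) (map (col M) ls)"
  have xy: "x \<in> carrier_vec p" "y \<in> carrier_vec p" using M by (auto simp: x_def y_def)
  have w: "?P {S. set ls \<subseteq> S} = ?w ls" if "distinct ls" "set ls \<subseteq> {..<n}" for ls
    using prob_det_process_superset[OF M orth that] by simp
  have avoid: "?P {S. set ls \<subseteq> S \<and> \<not> set is \<subseteq> S} = ?w ls - ?w (ls @ is)"
    if "distinct ls" "set ls \<subseteq> {..<n}" "set ls \<inter> set is = {}" for ls
    using prob_superset_diff[of "det_process M" "set ls" "set is"] w[of ls] w[of "ls @ is"] that lst
    by simp
  have \<kappa>w: "\<kappa> = ?w is" using \<kappa> w[of "is"] lst by simp
  have "?P {S. \<not> set is \<subseteq> S} = 1 - \<kappa>"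
    using avoid[of "[]"] \<kappa>w by simp
  moreover have "?P {S. i \<in> S \<and> \<not> set is \<subseteq> S} = wedge_inner [x] [x] - wedge_inner (x # map (col M) is) (x # map (col M) is)"
    using avoid[of "[i]"] ij by (simp add: x_def)
  moreover have "?P {S. j \<in> S \<and> \<not> set is \<subseteq> S} = wedge_inner [y] [y] - wedge_inner (y # map (col M) is) (y # map (col M) is)"
    using avoid[of "[j]"] ij by (simp add: y_def)
  moreover have "?P {S. (i \<in> S \<and> j \<in> S) \<and> \<not> set is \<subseteq> S} =
      wedge_inner [x, y] [x, y] - wedge_inner (x # y # map (col M) is) (x # y # map (col M) is)"
    using avoid[of "[i, j]"] ij by (simp add: x_def y_def)
  moreover have "a / u * (b / u) - c / u = u powi (- 2) * (a * b - c * u)" if "u \<noteq> 0" for a b c u :: real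
    using that by (simp add: power_int_minus power2_eq_square field_simps)
  from this[of "1 - \<kappa>"] have "a / (1 - \<kappa>) * (b / (1 - \<kappa>)) - c / (1 - \<kappa>) =
      (1 - \<kappa>) powi (- 2) * (a * b - c * (1 - \<kappa>))" for a b c
    using \<kappa>(2) by simp
  ultimately show ?thesis
    using correlation_identity[OF xy] \<kappa>w by (simp add: cond_prob_def wedge_inner_1)
qed

text \<open>As many independent vectors as the dimension span everything: the matrix of columns is
  invertible, and \<open>Z\<close> is its inverse. With this projection all residual terms of the
  correlation formula vanish.\<close>

lemma span_projection_full:
  assumes fs: "set fs \<subseteq> carrier_vec n" "length fs = n" and nz: "wedge_inner fs fs \<noteq> 0"
  obtains Z where "span_projection n fs (1\<^sub>m n) Z"
proof -
  let ?F = "mat_of_cols n fs"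
  have F: "?F \<in> carrier_mat n n" using fs(2) by auto
  have "wedge_inner fs fs = det ?F\<^sup>T * det ?F"
    using wedge_inner_mat_of_cols[OF fs(1) fs(1)] F by (simp add: det_mult)
  then have "det ?F \<noteq> 0" using nz by auto
  from det_non_zero_imp_unit[OF F this] obtain H where "H \<in> carrier_mat n n" "?F * H = 1\<^sub>m n"
    by (auto simp: Units_def ring_mat_def)
  then have "span_projection n fs (1\<^sub>m n) H"
    using F fs by unfold_locales auto
  then show thesis by (rule that)
qed

text \<open>For orthonormal rows, \<open>M\<^sup>T * M\<close> is the orthogonal projection onto the
  row space, so the row space determines it. Its entries are the inner products of the columns of
  \<open>M\<close>, which is how basis independence enters.\<close>

lemma gram_matrix_eq_of_row_space_eq:
  fixes M M' :: "real mat"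
  assumes M: "M \<in> carrier_mat p n" and orth: "orthonormal n (rows M)"
    and M': "M' \<in> carrier_mat p n" and orth': "orthonormal n (rows M')"
    and eq: "vec_space.row_space n M' = vec_space.row_space n M"
  shows "M\<^sup>T * M = M'\<^sup>T * M'"
proof -
  have MMT: "A * A\<^sup>T = 1\<^sub>m p" if A: "A \<in> carrier_mat p n" "orthonormal n (rows A)" for A
    by (rule eq_matI) (use A orthonormal_rows_inner[OF A] in \<open>auto simp: scalar_prod_def lessThan_atLeast0\<close>)
  have absorb: "B * (A\<^sup>T * A) = B"
    if A: "A \<in> carrier_mat p n" "orthonormal n (rows A)" and B: "B \<in> carrier_mat p n"
      and eq: "vec_space.row_space n A = vec_space.row_space n B" for A B
  proof -
    \<comment> \<open>Vectors of the row space have the form \<open>A\<^sup>T *\<^sub>v y\<close>;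
      they are fixed because \<open>A * A\<^sup>T\<close> is the identity.\<close>
    have row: "(A\<^sup>T * A) *\<^sub>v r = r" if r: "r \<in> vec_space.row_space n A" for r
    proof -
      obtain y where y: "y \<in> carrier_vec p" "r = A\<^sup>T *\<^sub>v y"
        using r A vec_space.row_space_eq[OF A(1)] by auto
      have "(A\<^sup>T * A) *\<^sub>v r = A\<^sup>T *\<^sub>v ((A * A\<^sup>T) *\<^sub>v y)"
        using A(1) y by (simp add: assoc_mult_mat_vec[of _ n p _ n] assoc_mult_mat_vec[of _ p n _ p])
      then show ?thesis using MMT[OF A] y by simp
    qed
    have rows: "row B k \<in> vec_space.row_space n A" if "k < p" for k
    proof -
      have "B\<^sup>T *\<^sub>v unit_vec p k = row B k"
        by (rule eq_vecI) (use B that in \<open>auto simp: scalar_prod_right_unit\<close>)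
      then have "row B k \<in> vec_space.row_space n B"
        using vec_space.row_space_eq[OF B] B that by auto
      then show ?thesis using eq by simp
    qed
    have "A\<^sup>T * A * B\<^sup>T = B\<^sup>T"
    proof (rule eq_matI)
      fix i k assume "i < dim_row B\<^sup>T" "k < dim_col B\<^sup>T"
      then have ik: "i < n" "k < p" using B by auto
      have "(A\<^sup>T * A * B\<^sup>T) $$ (i, k) = col (A\<^sup>T * A * B\<^sup>T) k $ i"
        using ik A(1) B by (intro index_col[symmetric]) auto
      also have "col (A\<^sup>T * A * B\<^sup>T) k = (A\<^sup>T * A) *\<^sub>v col B\<^sup>T k"
        by (rule col_mult2[of _ n n _ p]) (use ik A(1) B in auto)
      also have "\<dots> = row B k" using row[OF rows[OF ik(2)]] ik B by simp
      finally show "(A\<^sup>T * A * B\<^sup>T) $$ (i, k) = B\<^sup>T $$ (i, k)" using ik B by simp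
    qed (use A(1) B in auto)
    then have "(A\<^sup>T * A * B\<^sup>T)\<^sup>T = B" by simp
    moreover have "(A\<^sup>T * A * B\<^sup>T)\<^sup>T = B * (A\<^sup>T * A)"
      using transpose_mult[of "A\<^sup>T * A" n n "B\<^sup>T" p] transpose_mult[of "A\<^sup>T" n p A n] A(1) B
      by simp
    ultimately show ?thesis by simp
  qed
  define K where "K = M\<^sup>T * M"
  define K' where "K' = M'\<^sup>T * M'"
  have K: "K \<in> carrier_mat n n" "K' \<in> carrier_mat n n" "K\<^sup>T = K" "K'\<^sup>T = K'"
    using M M' by (auto simp: K_def K'_def transpose_mult[of _ n p _ n])
  have "K' * K = K'"
    using absorb[OF M orth M' eq[symmetric]] M M' by (simp add: K_def K'_def assoc_mult_mat[of _ n p _ n _ n])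
  moreover have "K * K' = K"
    using absorb[OF M' orth' M eq] M M' by (simp add: K_def K'_def assoc_mult_mat[of _ n p _ n _ n])
  \<comment> \<open>Transposing \<open>K * K' = K\<close> gives \<open>K' * K = K\<close>, to be
    compared with \<open>K' * K = K'\<close>.\<close>
  ultimately have "K = K'" using transpose_mult[OF K(1,2)] K by simp
  then show ?thesis by (simp add: K_def K'_def)
qed


text \<open>\<open>wedge_inner\<close> sees vectors only through their inner products; this
  transfers equality of Gram matrices to every wedge expression.\<close>

lemma wedge_inner_map_cong:
  assumes "\<And>x y. x \<in> set is \<Longrightarrow> y \<in> set js \<Longrightarrow> f x \<bullet> f y = g x \<bullet> g y"
  shows "wedge_inner (map f is) (map f js) = wedge_inner (map g is) (map g js)"
proof -
  have "mat (length (map f is)) (length (map f js)) (\<lambda>(s, t). map f is ! s \<bullet> map f js ! t)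
    = mat (length (map g is)) (length (map g js)) (\<lambda>(s, t). map g is ! s \<bullet> map g js ! t)"
    by (rule eq_matI) (use assms in auto)
  then show ?thesis by (simp only: wedge_inner_def)
qed

section \<open>Projection onto the first \<open>m\<close> coordinates\<close>

definition leading_projection :: "nat \<Rightarrow> nat \<Rightarrow> real mat" where
  "leading_projection p m = mat p p (\<lambda>(a, b). if a = b \<and> a < m then 1 else 0)"

lemma leading_projection_mult_vec:
  assumes "z \<in> carrier_vec p" "a < p"
  shows "(leading_projection p m *\<^sub>v z) $ a = (if a < m then z $ a else 0)"
proof -
  have "(leading_projection p m *\<^sub>v z) $ a = (\<Sum>b = 0..<p. (if a = b \<and> a < m then 1 else 0) * z $ b)"
    using assms by (simp add: leading_projection_def scalar_prod_def)
  also have "\<dots> = (\<Sum>b = 0..<p. if b = a then (if a < m then z $ a else 0) else 0)"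
    by (rule sum.cong) auto
  finally have "(leading_projection p m *\<^sub>v z) $ a = (\<Sum>b = 0..<p. if b = a then (if a < m then z $ a else 0) else 0)" .
  then show ?thesis using assms by simp
qed

lemma leading_projection_append:
  assumes "v \<in> carrier_vec m" "w \<in> carrier_vec (p - m)" "m \<le> p"
  shows "leading_projection p m *\<^sub>v (v @\<^sub>v w) = v @\<^sub>v 0\<^sub>v (p - m)"
proof (rule eq_vecI)
  fix a assume "a < dim_vec (v @\<^sub>v 0\<^sub>v (p - m))"
  then have "a < p" using assms by simp
  moreover have "v @\<^sub>v w \<in> carrier_vec p" using append_carrier_vec[OF assms(1,2)] assms(3) by simp
  ultimately show "(leading_projection p m *\<^sub>v (v @\<^sub>v w)) $ a = (v @\<^sub>v 0\<^sub>v (p - m)) $ a"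
    using assms by (simp add: leading_projection_mult_vec)
qed (use assms in \<open>simp add: leading_projection_def\<close>)

text \<open>The vectors are the columns of an invertible matrix padded with zeros, so they span
  exactly the first \<open>m\<close> coordinates.\<close>

lemma span_projection_leading:
  fixes C :: "real mat"
  assumes C: "C \<in> carrier_mat m m" and m: "m \<le> p" and fs: "length fs = m"
    and cols: "\<And>l. l < m \<Longrightarrow> fs ! l = col C l @\<^sub>v 0\<^sub>v (p - m)" and nz: "det C \<noteq> 0"
  obtains Z where "span_projection p fs (leading_projection p m) Z"
proof -
  let ?Q = "leading_projection p m" and ?F = "mat_of_cols p fs"
  have col_carrier: "col C l @\<^sub>v 0\<^sub>v (p - m) \<in> carrier_vec p" if "l < m" for l
    using append_carrier_vec[of "col C l" m "0\<^sub>v (p - m)" "p - m"] C m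
    by (simp add: carrier_dim_vec)
  have fsc: "set fs \<subseteq> carrier_vec p"
    using fs cols col_carrier by (metis in_set_conv_nth subsetI)
  have F: "?F \<in> carrier_mat p m" using fs by auto
  have colF: "col ?F l = col C l @\<^sub>v 0\<^sub>v (p - m)" if "l < m" for l
    using that fs cols col_carrier by (simp add: col_mat_of_cols)
  have Fi: "?F $$ (a, l) = (if a < m then C $$ (a, l) else 0)" if "a < p" "l < m" for a l
  proof -
    have "?F $$ (a, l) = col ?F l $ a" by (rule index_col[symmetric]) (use that F in auto)
    then show ?thesis using that C m by (simp add: colF)
  qed
  have Q: "?Q \<in> carrier_mat p p" by (simp add: leading_projection_def)
  from det_non_zero_imp_unit[OF C nz] obtain H where H: "H \<in> carrier_mat m m" "C * H = 1\<^sub>m m"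
    by (auto simp: Units_def ring_mat_def)
  \<comment> \<open>The inverse of \<open>C\<close> padded with zero columns, so that
    \<open>?F * Z\<close> has an identity of size \<open>m\<close> as leading block and zeros
    elsewhere.\<close>
  define Z where "Z = mat m p (\<lambda>(l, b). if b < m then H $$ (l, b) else 0)"
  have "?Q * ?F = ?F"
  proof (rule eq_matI)
    fix a l assume "a < dim_row ?F" "l < dim_col ?F"
    then have al: "a < p" "l < m" using F by auto
    have "(?Q * ?F) $$ (a, l) = (?Q *\<^sub>v col ?F l) $ a"
      using al Q F fs by simp
    also have "\<dots> = (if a < m then col ?F l $ a else 0)"
      by (rule leading_projection_mult_vec) (use al F fs in auto)
    also have "col ?F l $ a = ?F $$ (a, l)"
      by (rule index_col) (use al F in auto)
    also have "(if a < m then ?F $$ (a, l) else 0) = ?F $$ (a, l)"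
      using Fi[OF al] by simp
    finally show "(?Q * ?F) $$ (a, l) = ?F $$ (a, l)" .
  qed (use Q in auto)
  moreover have "?Q = ?F * Z"
  proof (rule eq_matI)
    fix a b assume "a < dim_row (?F * Z)" "b < dim_col (?F * Z)"
    then have ab: "a < p" "b < p" by (auto simp: Z_def)
    have "(?F * Z) $$ (a, b) = (\<Sum>l = 0..<m. ?F $$ (a, l) * Z $$ (l, b))"
      using ab F fs by (auto simp: scalar_prod_def Z_def intro!: sum.cong)
    also have "\<dots> = (\<Sum>l = 0..<m. if a < m \<and> b < m then C $$ (a, l) * H $$ (l, b) else 0)"
      using ab by (intro sum.cong) (auto simp: Fi Z_def)
    also have "\<dots> = (if a < m \<and> b < m then (C * H) $$ (a, b) else 0)"
      using C H(1) by (cases "a < m \<and> b < m") (auto simp: scalar_prod_def)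
    also have "\<dots> = ?Q $$ (a, b)"
      using ab by (simp add: H leading_projection_def)
    finally show "?Q $$ (a, b) = (?F * Z) $$ (a, b)" by simp
  qed (use Q F in \<open>auto simp: Z_def\<close>)
  moreover have "?Q\<^sup>T = ?Q" by (rule eq_matI) (auto simp: leading_projection_def)
  ultimately have "span_projection p fs ?Q Z"
    using Q fsc fs by unfold_locales (auto simp: Z_def)
  then show thesis by (rule that)
qed

lemma det_orthonormal_rows_squared:
  assumes "orthonormal m us" "length us = m"
  shows "(det (mat\<^sub>r m m (\<lambda>k. us ! k)))\<^sup>2 = 1"
proof -
  let ?U = "mat\<^sub>r m m (\<lambda>k. us ! k)"
  have U: "?U \<in> carrier_mat m m" by simp
  have "us ! k \<in> carrier_vec m" if "k < m" for k
    using that assms nth_mem[of k us] by (auto simp: orthonormal_def)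
  then have "?U * ?U\<^sup>T = 1\<^sub>m m"
    by (intro eq_matI) (use assms in \<open>auto simp: orthonormal_def\<close>)
  then show ?thesis
    using det_mult[OF U, of "?U\<^sup>T"] det_transpose[OF U] U by (simp add: power2_eq_square)
qed

section \<open>Columns of a basis in CS form\<close>

locale cs_basis =
  fixes p n m :: nat and M :: "real mat" and "is" :: "nat list" and i j rs \<theta>s us Vs Ws
  assumes M: "M \<in> carrier_mat p n" and m_def: "m = length is" and m_le: "m \<le> p"
    and cs: "cs_form M is i j rs \<theta>s us Vs Ws"
begin

abbreviation "ks \<equiv> is @ [i, j] @ rs"

lemma
  shows ks: "distinct ks" "set ks = {..<n}"
    and lengths: "length \<theta>s = m" "length us = m" "length Vs = m" "length Ws = p - m"
    and us: "orthonormal m us" and VWs: "orthonormal (n - m) (Vs @ Ws)"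
    and leading_rows: "\<And>k. k < m \<Longrightarrow> reorder ks (row M k) =
      cos (\<theta>s ! k) \<cdot>\<^sub>v us ! k @\<^sub>v sin (\<theta>s ! k) \<cdot>\<^sub>v Vs ! k"
    and trailing_rows: "\<And>k. k < p - m \<Longrightarrow> reorder ks (row M (m + k)) = 0\<^sub>v m @\<^sub>v Ws ! k"
  using cs M unfolding cs_form_def Let_def m_def by auto

lemma length_ks: "length ks = n"
  using distinct_card[OF ks(1)] ks(2) by simp

lemma entry:
  assumes "k < p" "s < n"
  shows "M $$ (k, ks ! s) = reorder ks (row M k) $ s"
proof -
  have "ks ! s < n" using nth_mem[of s ks] ks(2) assms(2) length_ks by auto
  then show ?thesis using assms M length_ks by (simp add: reorder_def)
qed

lemma carriers:
  shows "k < m \<Longrightarrow> us ! k \<in> carrier_vec m" "k < m \<Longrightarrow> Vs ! k \<in> carrier_vec (n - m)"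
    "k < p - m \<Longrightarrow> Ws ! k \<in> carrier_vec (n - m)"
  using us VWs lengths nth_mem[of k us] nth_mem[of k Vs] nth_mem[of k Ws]
  by (auto simp: orthonormal_def)

lemma m_less: "m + 2 \<le> n"
  using length_ks by (simp add: m_def)

text \<open>Positions \<open>m\<close> and \<open>m + 1\<close> of \<open>ks\<close> hold
  \<open>i\<close> and \<open>j\<close>, so \<open>s - m\<close> is the coordinate read off in the
  second factor. The first \<open>m\<close> rows contribute the sine parts, the others the entries
  of \<open>Ws\<close>.\<close>

lemma col_coordinate:
  assumes s: "s = m \<or> s = m + 1"
  shows "col M (ks ! s) = v_tilde \<theta>s Vs (s - m) @\<^sub>v W_coord Ws (s - m)"
proof (rule eq_vecI)
  have sn: "s < n" using s m_less by auto
  have ksn: "ks ! s < n" using nth_mem[of s ks] ks(2) sn length_ks by auto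
  fix a assume "a < dim_vec (v_tilde \<theta>s Vs (s - m) @\<^sub>v W_coord Ws (s - m))"
  then have a: "a < p" using lengths m_le by (simp add: v_tilde_def W_coord_def)
  have "col M (ks ! s) $ a = reorder ks (row M a) $ s"
    using entry[OF a sn] M a ksn by simp
  also have "\<dots> = (v_tilde \<theta>s Vs (s - m) @\<^sub>v W_coord Ws (s - m)) $ a"
  proof (cases "a < m")
    case True
    then show ?thesis
      using s sn leading_rows[OF True] carriers[of a] lengths by (auto simp: v_tilde_def W_coord_def)
  next
    case False
    then have "a - m < p - m" "m + (a - m) = a" using a by auto
    then show ?thesis
      using s sn trailing_rows[of "a - m"] carriers(3)[of "a - m"] lengths False
      by (auto simp: v_tilde_def W_coord_def)
  qed
  finally show "col M (ks ! s) $ a = (v_tilde \<theta>s Vs (s - m) @\<^sub>v W_coord Ws (s - m)) $ a" .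
qed (use M lengths m_le in \<open>simp add: v_tilde_def W_coord_def\<close>)

lemma col_i: "col M i = v_tilde \<theta>s Vs 0 @\<^sub>v W_coord Ws 0"
  using col_coordinate[of m] by (simp add: nth_append m_def)

lemma col_j: "col M j = v_tilde \<theta>s Vs 1 @\<^sub>v W_coord Ws 1"
  using col_coordinate[of "m + 1"] by (simp add: nth_append m_def)

text \<open>The upper block of the columns listed in \<open>is\<close>: the diagonal matrix of the
  cosines times the orthogonal matrix with rows \<open>us\<close>.\<close>

definition C where "C = mat\<^sub>r m m (\<lambda>k. cos (\<theta>s ! k) \<cdot>\<^sub>v us ! k)"

lemma C_carrier: "C \<in> carrier_mat m m"
  by (simp add: C_def)

text \<open>Rows after the first \<open>m\<close> vanish on the coordinates in
  \<open>is\<close>.\<close>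

lemma col_is:
  assumes l: "l < m"
  shows "map (col M) is ! l = col C l @\<^sub>v 0\<^sub>v (p - m)"
proof (rule eq_vecI)
  have ln: "l < n" using l m_less by simp
  have ksl: "ks ! l = is ! l" using l by (simp add: nth_append m_def)
  have ksn: "is ! l < n" using nth_mem[of l ks] ks(2) ln length_ks ksl by auto
  fix a assume "a < dim_vec (col C l @\<^sub>v 0\<^sub>v (p - m))"
  then have a: "a < p" using C_carrier m_le by simp
  have "map (col M) is ! l $ a = reorder ks (row M a) $ l"
    using entry[OF a ln] M a ksn ksl l by (simp add: m_def)
  also have "\<dots> = (col C l @\<^sub>v 0\<^sub>v (p - m)) $ a"
  proof (cases "a < m")
    case True
    then show ?thesis
      using l leading_rows[OF True] carriers[of a] by (simp add: C_def)
  next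
    case False
    then have "a - m < p - m" "m + (a - m) = a" using a by auto
    then show ?thesis
      using l trailing_rows[of "a - m"] carriers(3)[of "a - m"] False C_carrier by simp
  qed
  finally show "map (col M) is ! l $ a = (col C l @\<^sub>v 0\<^sub>v (p - m)) $ a" .
qed (use M m_le C_carrier l in \<open>simp add: m_def\<close>)

lemma wedge_inner_is_det: "wedge_inner (map (col M) is) (map (col M) is) = (det C)\<^sup>2"
proof -
  have "map (col M) is ! s \<bullet> map (col M) is ! t = col C s \<bullet> col C t" if "s < m" "t < m" for s t
    unfolding col_is[OF that(1)] col_is[OF that(2)]
    by (subst scalar_prod_append[of _ m _ "p - m"]) (use C_carrier in \<open>auto simp: carrier_dim_vec\<close>)
  then have "mat m m (\<lambda>(s, t). map (col M) is ! s \<bullet> map (col M) is ! t) = C\<^sup>T * C"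
    by (intro eq_matI) (use C_carrier in auto)
  then show ?thesis
    using det_mult[of "C\<^sup>T" m C] det_transpose[OF C_carrier] C_carrier
    by (simp add: wedge_inner_def m_def power2_eq_square)
qed

text \<open>The cosines factor out of the rows, and the orthogonal matrix left over has squared
  determinant 1. With \<open>wedge_inner_is_det\<close> this is the product formula for
  \<open>\<kappa>\<close>.\<close>

lemma det_C_squared: "(det C)\<^sup>2 = (\<Prod>k<m. (cos (\<theta>s ! k))\<^sup>2)"
proof -
  have "det C = (\<Prod>k = 0..<m. cos (\<theta>s ! k)) * det (mat\<^sub>r m m (\<lambda>k. us ! k))"
    unfolding C_def by (rule det_rows_mul) (use carriers(1) in auto)
  then show ?thesis
    using det_orthonormal_rows_squared[OF us lengths(2)]
    by (simp add: power_mult_distrib prod_power_distrib lessThan_atLeast0)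
qed

lemma v_W_carrier:
  "v_tilde \<theta>s Vs l \<in> carrier_vec m" "W_coord Ws l \<in> carrier_vec (p - m)"
  by (simp_all add: v_tilde_def W_coord_def lengths)

lemma col_inner:
  "col M i \<bullet> col M j = v_tilde \<theta>s Vs 0 \<bullet> v_tilde \<theta>s Vs 1 + W_coord Ws 0 \<bullet> W_coord Ws 1"
  unfolding col_i col_j by (rule scalar_prod_append) (rule v_W_carrier)+

text \<open>The projection keeps the \<open>v_tilde\<close> part and erases the
  \<open>W_coord\<close> part, so these two give the projected and residual parts of the inner
  products.\<close>

lemma col_inner_leading:
  "col M i \<bullet> (leading_projection p m *\<^sub>v col M j) = v_tilde \<theta>s Vs 0 \<bullet> v_tilde \<theta>s Vs 1"
  "col M i \<bullet> (leading_projection p m *\<^sub>v col M i) = v_tilde \<theta>s Vs 0 \<bullet> v_tilde \<theta>s Vs 0"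
  "col M j \<bullet> (leading_projection p m *\<^sub>v col M j) = v_tilde \<theta>s Vs 1 \<bullet> v_tilde \<theta>s Vs 1"
proof -
  have "(v_tilde \<theta>s Vs l @\<^sub>v W_coord Ws l) \<bullet> (leading_projection p m *\<^sub>v (v_tilde \<theta>s Vs l' @\<^sub>v W_coord Ws l'))
    = v_tilde \<theta>s Vs l \<bullet> v_tilde \<theta>s Vs l'" for l l'
    unfolding leading_projection_append[OF v_W_carrier m_le]
    using v_W_carrier by (subst scalar_prod_append[of _ m _ "p - m"]) auto
  then show "col M i \<bullet> (leading_projection p m *\<^sub>v col M j) = v_tilde \<theta>s Vs 0 \<bullet> v_tilde \<theta>s Vs 1"
    "col M i \<bullet> (leading_projection p m *\<^sub>v col M i) = v_tilde \<theta>s Vs 0 \<bullet> v_tilde \<theta>s Vs 0"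
    "col M j \<bullet> (leading_projection p m *\<^sub>v col M j) = v_tilde \<theta>s Vs 1 \<bullet> v_tilde \<theta>s Vs 1"
    unfolding col_i col_j by blast+
qed

end

theorem theorem1:
  fixes p N :: nat and M :: "real mat"
  assumes "1 < p" and "p < N"
    and "M \<in> carrier_mat p N"
    and "orthonormal N (rows M)"
  shows
    "(\<forall>is i j A m \<kappa>.
        distinct is \<and> set is = A \<and> length is = m \<and> A \<subseteq> {..<N} \<and> i < N \<and> j < N \<and>
        i \<noteq> j \<and> i \<notin> A \<and> j \<notin> A \<and> m \<le> p \<and>
        \<kappa> = \<P>(S in det_process M. A \<subseteq> S) \<and> 0 < \<kappa> \<and> \<kappa> < 1 \<longrightarrow>
        (m = p \<longrightarrow>
           \<P>(S in det_process M. i \<in> S \<bar> \<not> A \<subseteq> S) * \<P>(S in det_process M. j \<in> S \<bar> \<not> A \<subseteq> S)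
             - \<P>(S in det_process M. i \<in> S \<and> j \<in> S \<bar> \<not> A \<subseteq> S)
           = (1 - \<kappa>) powi (- 2) *
               ((col M i \<bullet> col M j)\<^sup>2 + \<kappa> * (wedge_norm [col M i, col M j])\<^sup>2) \<and>
           (\<forall>M' \<in> carrier_mat p N. orthonormal N (rows M') \<and>
              vec_space.row_space N M' = vec_space.row_space N M \<longrightarrow>
              (let \<kappa>' = \<P>(S in det_process M'. A \<subseteq> S) in
                (1 - \<kappa>') powi (- 2) *
                  ((col M' i \<bullet> col M' j)\<^sup>2 + \<kappa>' * (wedge_norm [col M' i, col M' j])\<^sup>2))
              = (1 - \<kappa>) powi (- 2) *
                  ((col M i \<bullet> col M j)\<^sup>2 + \<kappa> * (wedge_norm [col M i, col M j])\<^sup>2))) \<and>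
        (m < p \<longrightarrow>
           (\<forall>rs \<theta>s us Vs Ws. cs_form M is i j rs \<theta>s us Vs Ws \<longrightarrow>
              \<kappa> = (\<Prod>k<m. (cos (\<theta>s ! k))\<^sup>2) \<and>
              \<P>(S in det_process M. i \<in> S \<bar> \<not> A \<subseteq> S) * \<P>(S in det_process M. j \<in> S \<bar> \<not> A \<subseteq> S)
                - \<P>(S in det_process M. i \<in> S \<and> j \<in> S \<bar> \<not> A \<subseteq> S)
              = (1 - \<kappa>) powi (- 2) *
                  ((v_tilde \<theta>s Vs 0 \<bullet> v_tilde \<theta>s Vs 1
                      + (1 - \<kappa>) * (W_coord Ws 0 \<bullet> W_coord Ws 1))\<^sup>2
                    + \<kappa> * (wedge_norm [v_tilde \<theta>s Vs 0, v_tilde \<theta>s Vs 1])\<^sup>2) \<and>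
              v_tilde \<theta>s Vs 0 \<bullet> v_tilde \<theta>s Vs 1 + (1 - \<kappa>) * (W_coord Ws 0 \<bullet> W_coord Ws 1)
              = col M i \<bullet> col M j
                - wedge_inner (col M i # map (col M) is) (col M j # map (col M) is)) \<and>
           (\<forall>M' \<in> carrier_mat p N. orthonormal N (rows M') \<and>
              vec_space.row_space N M' = vec_space.row_space N M \<longrightarrow>
              col M' i \<bullet> col M' j
                - wedge_inner (col M' i # map (col M') is) (col M' j # map (col M') is)
              = col M i \<bullet> col M j
                - wedge_inner (col M i # map (col M) is) (col M j # map (col M) is))))
     \<and>
     (\<forall>A A1 A2. A \<subseteq> {..<N} \<and> A1 \<subseteq> {..<N} \<and> A2 \<subseteq> {..<N} \<and>
        A \<inter> A1 = {} \<and> A \<inter> A2 = {} \<and> A1 \<inter> A2 = {} \<and>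
        \<P>(S in det_process M. \<not> A1 \<subseteq> S \<and> \<not> A2 \<subseteq> S) > 0 \<longrightarrow>
        \<P>(S in det_process M. \<not> A \<subseteq> S \<bar> \<not> A1 \<subseteq> S \<and> \<not> A2 \<subseteq> S)
        \<le> \<P>(S in det_process M. \<not> A \<subseteq> S \<bar> \<not> A1 \<subseteq> S))"
proof (intro conjI allI impI)
  note M = assms(3) and orth = assms(4)
  {
    fix "is" :: "nat list" and i j :: nat and A m \<kappa>
    assume *: "distinct is \<and> set is = A \<and> length is = m \<and> A \<subseteq> {..<N} \<and> i < N \<and> j < N \<and>
        i \<noteq> j \<and> i \<notin> A \<and> j \<notin> A \<and> m \<le> p \<and>
        \<kappa> = \<P>(S in det_process M. A \<subseteq> S) \<and> 0 < \<kappa> \<and> \<kappa> < 1"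
    then have lst: "distinct is" "set is \<subseteq> {..<N}" and A: "A = set is" and len: "length is = m"
      and ij: "i < N" "j < N" "i \<noteq> j" "i \<notin> set is" "j \<notin> set is" and "m \<le> p"
      and \<kappa>: "\<kappa> = \<P>(S in det_process M. set is \<subseteq> S)" "0 < \<kappa>" "\<kappa> \<noteq> 1"
      by auto
    let ?F = "map (col M) is"
    have Fc: "set ?F \<subseteq> carrier_vec p" and c: "col M i \<in> carrier_vec p" "col M j \<in> carrier_vec p"
      using M by auto
    have \<kappa>w: "\<kappa> = wedge_inner ?F ?F"
      unfolding \<kappa>(1) by (rule prob_det_process_superset[OF M orth lst])
    note correlation = conditional_correlation[OF M orth lst ij \<kappa>(1,3)]
    \<comment> \<open>Both claims of basis independence reduce to the inner products of columns
      being determined by the row space.\<close>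
    have inner: "col M' k \<bullet> col M' l = col M k \<bullet> col M l"
      if "M' \<in> carrier_mat p N" "orthonormal N (rows M')"
        "vec_space.row_space N M' = vec_space.row_space N M" "k < N" "l < N" for M' k l
    proof -
      have "(M\<^sup>T * M) $$ (k, l) = (M'\<^sup>T * M') $$ (k, l)"
        using gram_matrix_eq_of_row_space_eq[OF M orth that(1-3)] by simp
      then show ?thesis using M that by simp
    qed
    {
      assume "m = p"
      then have "length ?F = p" using len by simp
      \<comment> \<open>Here the projection is the identity, so the projected inner products are
        those of the columns themselves.\<close>
      then obtain Z where proj: "span_projection p ?F (1\<^sub>m p) Z"
        using span_projection_full[OF Fc] \<kappa> \<kappa>w by auto
      show "\<P>(S in det_process M. i \<in> S \<bar> \<not> A \<subseteq> S) * \<P>(S in det_process M. j \<in> S \<bar> \<not> A \<subseteq> S)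
          - \<P>(S in det_process M. i \<in> S \<and> j \<in> S \<bar> \<not> A \<subseteq> S)
        = (1 - \<kappa>) powi (- 2) * ((col M i \<bullet> col M j)\<^sup>2 + \<kappa> * (wedge_norm [col M i, col M j])\<^sup>2)"
        unfolding A correlation[OF proj] wedge_norm_2_squared[OF c] using c by simp
      show "\<forall>M' \<in> carrier_mat p N. orthonormal N (rows M') \<and>
            vec_space.row_space N M' = vec_space.row_space N M \<longrightarrow>
          (let \<kappa>' = \<P>(S in det_process M'. A \<subseteq> S) in
            (1 - \<kappa>') powi (- 2) *
              ((col M' i \<bullet> col M' j)\<^sup>2 + \<kappa>' * (wedge_norm [col M' i, col M' j])\<^sup>2))
          = (1 - \<kappa>) powi (- 2) *
              ((col M i \<bullet> col M j)\<^sup>2 + \<kappa> * (wedge_norm [col M i, col M j])\<^sup>2)"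
      proof (intro ballI impI)
        fix M' :: "real mat"
        assume M': "M' \<in> carrier_mat p N" and "orthonormal N (rows M') \<and>
          vec_space.row_space N M' = vec_space.row_space N M"
        then have orth': "orthonormal N (rows M')" and
          eq: "vec_space.row_space N M' = vec_space.row_space N M" by auto
        note same = inner[OF M' orth' eq]
        have "\<P>(S in det_process M'. A \<subseteq> S) = wedge_inner (map (col M') is) (map (col M') is)"
          unfolding A by (rule prob_det_process_superset[OF M' orth' lst])
        also have "\<dots> = \<kappa>"
          unfolding \<kappa>w by (rule wedge_inner_map_cong) (use same lst in auto)
        finally have \<kappa>': "\<P>(S in det_process M'. A \<subseteq> S) = \<kappa>" .
        have "wedge_inner (map (col M') [i, j]) (map (col M') [i, j]) =
            wedge_inner (map (col M) [i, j]) (map (col M) [i, j])"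
          by (rule wedge_inner_map_cong) (use same ij in auto)
        then have "wedge_norm [col M' i, col M' j] = wedge_norm [col M i, col M j]"
          by (simp add: wedge_norm_def)
        then show "(let \<kappa>' = \<P>(S in det_process M'. A \<subseteq> S) in
            (1 - \<kappa>') powi (- 2) *
              ((col M' i \<bullet> col M' j)\<^sup>2 + \<kappa>' * (wedge_norm [col M' i, col M' j])\<^sup>2))
          = (1 - \<kappa>) powi (- 2) *
              ((col M i \<bullet> col M j)\<^sup>2 + \<kappa> * (wedge_norm [col M i, col M j])\<^sup>2)"
          unfolding \<kappa>' Let_def same[OF ij(1,2)] by simp
      qed
    next
      assume "m < p"
      fix rs \<theta>s us Vs Ws
      assume cs: "cs_form M is i j rs \<theta>s us Vs Ws"
      interpret cs_basis p N m M "is" i j rs \<theta>s us Vs Ws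
        by unfold_locales (use M len \<open>m \<le> p\<close> cs in auto)
      \<comment> \<open>\<open>\<kappa>\<close> is the square of \<open>det C\<close>, and it is
        positive.\<close>
      have "det C \<noteq> 0" using \<kappa> \<kappa>w wedge_inner_is_det by auto
      then obtain Z where proj: "span_projection p ?F (leading_projection p m) Z"
        using span_projection_leading[OF C_carrier m_le _ col_is] len by auto
      then interpret sp: span_projection p ?F "leading_projection p m" Z .
      let ?v = "v_tilde \<theta>s Vs" and ?W = "W_coord Ws"
      show "\<kappa> = (\<Prod>k<m. (cos (\<theta>s ! k))\<^sup>2)"
        using \<kappa>w wedge_inner_is_det det_C_squared by simp
      show "\<P>(S in det_process M. i \<in> S \<bar> \<not> A \<subseteq> S) * \<P>(S in det_process M. j \<in> S \<bar> \<not> A \<subseteq> S)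
          - \<P>(S in det_process M. i \<in> S \<and> j \<in> S \<bar> \<not> A \<subseteq> S)
        = (1 - \<kappa>) powi (- 2) *
            ((?v 0 \<bullet> ?v 1 + (1 - \<kappa>) * (?W 0 \<bullet> ?W 1))\<^sup>2 + \<kappa> * (wedge_norm [?v 0, ?v 1])\<^sup>2)"
        unfolding A correlation[OF proj] wedge_norm_2_squared[OF v_W_carrier(1) v_W_carrier(1)]
          col_inner_leading col_inner by simp
      show "?v 0 \<bullet> ?v 1 + (1 - \<kappa>) * (?W 0 \<bullet> ?W 1)
        = col M i \<bullet> col M j - wedge_inner (col M i # ?F) (col M j # ?F)"
        \<comment> \<open>The wedge term equals \<open>\<kappa>\<close> times the residual part
          \<open>?W 0 \<bullet> ?W 1\<close>; subtracting it from the full inner product leaves that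
          part with the factor \<open>1 - \<kappa>\<close>.\<close>
        unfolding sp.wedge_inner_Cons[OF c] col_inner_leading \<kappa>w[symmetric] col_inner
        by (simp add: algebra_simps)
    next
      show "\<forall>M' \<in> carrier_mat p N. orthonormal N (rows M') \<and>
            vec_space.row_space N M' = vec_space.row_space N M \<longrightarrow>
          col M' i \<bullet> col M' j
            - wedge_inner (col M' i # map (col M') is) (col M' j # map (col M') is)
          = col M i \<bullet> col M j - wedge_inner (col M i # ?F) (col M j # ?F)"
      proof (intro ballI impI)
        fix M' :: "real mat"
        assume M': "M' \<in> carrier_mat p N" and "orthonormal N (rows M') \<and>
          vec_space.row_space N M' = vec_space.row_space N M"
        then have same: "k < N \<Longrightarrow> l < N \<Longrightarrow> col M' k \<bullet> col M' l = col M k \<bullet> col M l" for k l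
          using inner[OF M'] by blast
        have "wedge_inner (map (col M') (i # is)) (map (col M') (j # is)) =
          wedge_inner (map (col M) (i # is)) (map (col M) (j # is))"
          by (rule wedge_inner_map_cong) (use same lst ij in auto)
        then show "col M' i \<bullet> col M' j
            - wedge_inner (col M' i # map (col M') is) (col M' j # map (col M') is)
          = col M i \<bullet> col M j - wedge_inner (col M i # ?F) (col M j # ?F)"
          using same[OF ij(1,2)] by simp
      qed
    }
  }
  fix A A1 A2
  assume "A \<subseteq> {..<N} \<and> A1 \<subseteq> {..<N} \<and> A2 \<subseteq> {..<N} \<and>
      A \<inter> A1 = {} \<and> A \<inter> A2 = {} \<and> A1 \<inter> A2 = {} \<and>
      \<P>(S in det_process M. \<not> A1 \<subseteq> S \<and> \<not> A2 \<subseteq> S) > 0"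
  then show "\<P>(S in det_process M. \<not> A \<subseteq> S \<bar> \<not> A1 \<subseteq> S \<and> \<not> A2 \<subseteq> S)
    \<le> \<P>(S in det_process M. \<not> A \<subseteq> S \<bar> \<not> A1 \<subseteq> S)"
    by (intro negative_correlation_conditional[OF M orth]) auto
qed

end
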